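(* Let $w\ge 4$, $u=w-2$, $v=w-1$, and let $\sum$ denote the sum over positive integers $b,c$ with $b+c=v$ (so the indices $(1,b,c)$ have weight $w$). Then, as identities of polynomials in $T$, \begin{align*} \sum \zeta_\sqcup(1,b,c)&=\zeta(2,u)+\zeta_*(1,v)+\zeta_*(1,1,u)-\tfrac12\zeta(2)\zeta(u),\\ \sum \zeta_\sqcup(1,\bar b,c)&=\zeta(\bar2,\bar u)+\zeta_*(1,v)+\zeta_*(1,\bar1,\bar u)+\zeta_*(1,\bar u,\bar1)+\zeta(\bar1,1,\bar u)-\zeta(\bar1,\bar1,\bar u)-\zeta_*(1,\bar u,1),\\ \sum \zeta(\bar1,b,c)&=\zeta(2,u)+\zeta(\bar1,\bar v)+\zeta(\bar1,u,\bar1)+2\zeta(\bar1,\bar1,u)-\zeta(\bar1,1,u)-\zeta(\bar1,u,1),\\ \sum \zeta(\bar1,\bar b,c)&=\zeta(\bar2,\bar u)+\zeta(\bar1,\bar v)+\zeta(\bar1,1,\bar u),\\ \sum \zeta(\bar1,\bar b,\bar c)&=\zeta(\bar2,u)+\zeta(\bar1,v)+\zeta(\bar1,u,1)+\zeta(\bar1,1,u)-\zeta(\bar1,u,\bar1),\\ \sum \zeta_\sqcup(1,b,\bar c)&=\zeta(2,\bar u)+\zeta_*(1,\bar v)+\zeta_*(1,\bar u,1)+\zeta_*(1,1,\bar u)-\zeta_\sqcup(1,\bar u,\bar1)-\tfrac12\zeta(2)\zeta(\bar u),\\ \sum \zeta_\sqcup(1,\bar b,\bar c)&=\zeta(\bar2,u)+\zeta_*(1,\bar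 v)+\zeta_*(1,\bar1,u)+\zeta(\bar1,1,u)-\zeta(\bar1,\bar1,u),\\ \sum \zeta(\bar1,b,\bar c)&=\zeta(2,\bar u)+\zeta(\bar1,v)+2\zeta(\bar1,\bar1,\bar u)-\zeta(\bar1,1,\bar u). \end{align*}
   Context: Euler sums: for positive integers $s_j$ and $z_j\in\{\pm1\}$, $\zeta(s_1,\dots,s_d;z_1,\dots,z_d)=\sum_{n_1>\dots>n_d>0}\frac{z_1^{n_1}\cdots z_d^{n_d}}{n_1^{s_1}\cdots n_d^{s_d}}$, convergent iff $(s_1,z_1)\ne(1,1)$; a bar over the $j$-th argument means $z_j=-1$, no bar means $z_j=1$. Regularized values: the truncated sum $\zeta^{(M)}$ (restricted to $M\ge n_1$) has, as $M\to\infty$, an expansion $P(\log M+\gamma)+o(1)$ with $P$ a polynomial ($\gamma$ Euler's constant); $\zeta_*:=P(T)\in\mathbb{R}[T]$. With $a_k=\prod_{j\le k}z_j$, $\int_0^{1-\varepsilon}\left(\frac{dt}{t}\right)^{s_1-1}\frac{dt}{a_1-t}\cdots\left(\frac{dt}{t}\right)^{s_d-1}\frac{dt}{a_d-t}$ (iterated integral over $1-\varepsilon>t_1>t_2>\dots>0$, forms read left to right) has, as $\varepsilon\to0^+$, an expansion $Q(-\log\varepsilon)+o(1)$; $\zeta_\sqcup:=Q(T)$. Both equal the Euler sum for convergent indices. *)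

theory Defs
  imports "HOL-Analysis.Analysis" "HOL-Computational_Algebra.Polynomial"
begin

text \<open>An index is a list of pairs (s_j, z_j) with s_j a positive integer and z_j \<in> {1,-1}.
  A bar over an argument means z_j = -1.\<close>

type_synonym eindex = "(nat \<times> real) list"

definition pl :: "nat \<Rightarrow> nat \<times> real" where "pl s = (s, 1)"
definition br :: "nat \<Rightarrow> nat \<times> real" where "br s = (s, -1)"

fun zetaM :: "eindex \<Rightarrow> nat \<Rightarrow> real" where
  "zetaM [] M = 1"
| "zetaM ((s, z) # rest) M = (\<Sum>n = 1..M. z ^ n / real n ^ s * zetaM rest (n - 1))"

text \<open>Euler sum (meaningful for convergent indices): limit of truncated sums.\<close>
definition euler_zeta :: "eindex \<Rightarrow> real" where
  "euler_zeta idx = lim (\<lambda>M. zetaM idx M)"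

definition zeta_st :: "eindex \<Rightarrow> real poly" where
  "zeta_st idx = (THE P. ((\<lambda>M. zetaM idx M - poly P (ln (real M) + euler_mascheroni))
                        \<longlongrightarrow> 0) sequentially)"

definition form :: "real option \<Rightarrow> real \<Rightarrow> real" where
  "form l t = (case l of None \<Rightarrow> 1 / t | Some a \<Rightarrow> 1 / (a - t))"

fun word_aux :: "real \<Rightarrow> eindex \<Rightarrow> real option list" where
  "word_aux a [] = []"
| "word_aux a ((s, z) # rest) = replicate (s - 1) None @ [Some (a * z)] @ word_aux (a * z) rest"

definition eword :: "eindex \<Rightarrow> real option list" where
  "eword idx = word_aux 1 idx"

fun iterint :: "real option list \<Rightarrow> real \<Rightarrow> real" where
  "iterint [] x = 1"
| "iterint (l # ls) x = integral {0..x} (\<lambda>t. form l t * iterint ls t)"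

definition zeta_sh :: "eindex \<Rightarrow> real poly" where
  "zeta_sh idx = (THE Q. ((\<lambda>e. iterint (eword idx) (1 - e) - poly Q (- ln e))
                        \<longlongrightarrow> 0) (at_right 0))"

definition zc :: "eindex \<Rightarrow> real poly" where
  "zc idx = [: euler_zeta idx :]"

end

theory Submission
  imports Defs "HOL-Real_Asymp.Real_Asymp"
begin

text \<open>
  Everything happens at the level of truncated sums. Summing the geometric progression
  \<open>\<Sum> p^-b q^-c = (q^-u - p^-u) / (p - q)\<close> over \<open>b + c = v\<close> turns the truncated left-hand side, up to
  \<open>\<zeta>(1,u,1)\<close> with suitable signs, into \<open>\<Sum>\<^sub>q \<epsilon>^q q^-u F\<^sub>q\<close>, where \<open>F\<^sub>q\<close> is the sum over \<open>q < n \<le> M\<close> of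
  \<open>z\<^sub>1^n / n\<close> times the harmonic sum of \<open>z\<^sub>2\<close> up to \<open>n - 1 - q\<close>. The right-hand side is a sum
  \<open>\<Sum>\<^sub>q \<epsilon>^q q^-u G\<^sub>q\<close> of the same shape. The increments in \<open>q\<close> of \<open>F\<^sub>q\<close> and \<open>G\<^sub>q\<close> differ by an explicit
  term that is at most \<open>H\<^sub>q / q\<close> and tends to \<open>0\<close> as \<open>M \<rightarrow> \<infinity>\<close>, so by dominated convergence the
  two sides differ by \<open>\<zeta>(u)\<close> (with sign \<open>\<epsilon>\<close>) times the limit of \<open>F\<^sub>0 - G\<^sub>0\<close>, which only involves double sums.

  Truncated sums of the relevant indices are \<open>a + b H\<^sub>M + c H\<^sub>M^2 + O(M^-1/2)\<close>. The iterated
  integral is the generating function of their increments, and as \<open>2 H\<^sub>n\<^sub>-\<^sub>1 / n\<close> has generating function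
  \<open>ln^2 (1 - x)\<close>, Abel's limit theorem shows that passing from the harmonic to the shuffle
  regularization replaces \<open>T^2\<close> by \<open>T^2 + \<zeta>(2)\<close>.
\<close>

section \<open>Expansions of truncated sums\<close>

text \<open>With a, b the square roots of x and x + 1, the difference 1/a - 1/b equals 1/(a b (a +
  b)), which is at least 1/(2 b^3) because a < b. This supplies a telescoping majorant for
  n^(-3/2).\<close>

lemma inverse_sqrt_diff_ge:
  fixes x :: real
  assumes "x > 0"
  shows "(x + 1) powr (-3/2) \<le> 2 * (x powr (-1/2) - (x + 1) powr (-1/2))"
proof -
  define a where "a = sqrt x"
  define b where "b = sqrt (x + 1)"
  have ab: "0 < a" "a < b" "b\<^sup>2 = a\<^sup>2 + 1" using assms by (auto simp: a_def b_def)
  have p1: "x powr (-1/2) = 1 / a" "(x + 1) powr (-1/2) = 1 / b"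
    using assms by (simp_all add: a_def b_def powr_minus_divide powr_half_sqrt)
  have "(x + 1) powr (-3/2) = (x + 1) powr (-1) * (x + 1) powr (-1/2)"
    by (subst powr_add [symmetric]) simp
  also have "\<dots> = 1 / b ^ 3"
    using assms unfolding p1 by (simp add: powr_minus_divide b_def power3_eq_cube)
  finally have p3: "(x + 1) powr (-3/2) = 1 / b ^ 3" .
  have "1 / a - 1 / b = (b - a) * (b + a) / (a * b * (a + b))"
    using ab by (simp add: divide_simps)
  also have "(b - a) * (b + a) = 1" using ab by (simp add: algebra_simps power2_eq_square)
  finally have "1 / a - 1 / b = 1 / (a * b * (a + b))" .
  moreover have "a * b * (a + b) \<le> b * b * (b + b)"
    using ab by (intro mult_mono) auto
  hence "1 / (2 * b ^ 3) \<le> 1 / (a * b * (a + b))"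
    using ab by (intro frac_le) (auto simp: power3_eq_cube)
  ultimately show ?thesis unfolding p1 p3 by simp
qed

text \<open>The increments are eventually dominated by those of the null sequence \<open>g\<close>.
  So the sequence is Cauchy, and \<open>g\<close> also bounds its distance from the limit.\<close>

lemma convergent_rate_of_increments:
  fixes S :: "nat \<Rightarrow> real"
  assumes "(\<lambda>n. S (Suc n) - S n) \<in> O(\<lambda>n. real n powr (-3/2))"
  obtains a where "(\<lambda>n. S n - a) \<in> O(\<lambda>n. real n powr (-1/2))"
proof -
  have "(\<lambda>n. real n powr (-3/2)) \<in> O(\<lambda>n. real (Suc n) powr (-3/2))"
    by real_asymp
  from landau_o.big_trans[OF assms this] obtain K where K: "K > 0"
    "eventually (\<lambda>n. norm (S (Suc n) - S n) \<le> K * norm (real (Suc n) powr (-3/2))) sequentially"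
    by (elim landau_o.bigE)
  from eventually_conj[OF K(2) eventually_gt_at_top[of 0]] obtain N
    where N: "N > 0" "\<And>n. n \<ge> N \<Longrightarrow> \<bar>S (Suc n) - S n\<bar> \<le> K * real (Suc n) powr (-3/2)"
    unfolding eventually_sequentially by auto
  define g where "g n = 2 * K * real n powr (-1/2)" for n
  have step: "\<bar>S (Suc n) - S n\<bar> \<le> g n - g (Suc n)" if "n \<ge> N" for n
  proof -
    have "K * real (Suc n) powr (-3/2) \<le> K * (2 * (real n powr (-1/2) - real (Suc n) powr (-1/2)))"
      using inverse_sqrt_diff_ge[of "real n"] that N K by (intro mult_left_mono) (auto simp: add.commute)
    with N(2)[OF that] show ?thesis by (simp add: g_def algebra_simps)
  qed
  have tele: "\<bar>S (n + k) - S n\<bar> \<le> g n - g (n + k)" if "n \<ge> N" for n k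
  proof (induction k)
    case (Suc k)
    thus ?case using step[of "n + k"] that by simp
  qed auto
  have g0: "g \<longlonglongrightarrow> 0" unfolding g_def by real_asymp
  have gnn: "g n \<ge> 0" for n using K by (simp add: g_def)
  have bound: "\<bar>S m - S n\<bar> \<le> g n" if "m \<ge> n" "n \<ge> N" for m n
    using tele[of n "m - n"] that gnn[of m] by simp
  have "Cauchy S"
  proof (rule metric_CauchyI)
    fix e :: real assume "e > 0"
    hence "eventually (\<lambda>n. g n < e / 2) sequentially"
      using order_tendstoD(2)[OF g0, of "e/2"] by simp
    then obtain M0 where M0: "\<And>n. n \<ge> M0 \<Longrightarrow> g n < e / 2" by (auto simp: eventually_sequentially)
    define M where "M = max M0 N"
    have "dist (S m) (S n) < e" if "m \<ge> M" "n \<ge> M" for m n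
      using bound[of M m] bound[of M n] M0[of M] that by (auto simp: M_def dist_real_def)
    thus "\<exists>M. \<forall>m\<ge>M. \<forall>n\<ge>M. dist (S m) (S n) < e" by blast
  qed
  then obtain a where a: "S \<longlonglongrightarrow> a" by (auto simp: Cauchy_convergent_iff convergent_def)
  have "\<bar>S n - a\<bar> \<le> g n" if "n \<ge> N" for n
  proof -
    have "(\<lambda>m. \<bar>S m - S n\<bar>) \<longlonglongrightarrow> \<bar>a - S n\<bar>" by (intro tendsto_intros a)
    moreover have "eventually (\<lambda>m. \<bar>S m - S n\<bar> \<le> g n) sequentially"
      using eventually_ge_at_top[of n] by eventually_elim (use bound that in auto)
    ultimately have "\<bar>a - S n\<bar> \<le> g n"
      by (rule tendsto_upperbound) simp
    thus ?thesis by (simp add: abs_minus_commute)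
  qed
  hence "(\<lambda>n. S n - a) \<in> O(\<lambda>n. real n powr (-1/2))"
    by (intro landau_o.bigI[of "2 * K"])
       (use K in \<open>auto simp: g_def eventually_sequentially abs_mult intro!: exI[of _ N]\<close>)
  thus ?thesis by (rule that)
qed

lemma harm_bigo_powr:
  assumes "c > 0"
  shows "(harm :: nat \<Rightarrow> real) \<in> O(\<lambda>n. real n powr c)"
proof -
  have "(\<lambda>n. (harm n - ln (real n)) + ln (real n)) \<in> O(\<lambda>n. real n powr c)"
  proof (rule sum_in_bigo)
    have "(\<lambda>n. harm n - ln (real n)) \<in> O(\<lambda>_. 1 :: real)"
      by (rule bigoI_tendsto[of _ _ euler_mascheroni]) (use euler_mascheroni_LIMSEQ in auto)
    also have "(\<lambda>_. 1 :: real) \<in> O(\<lambda>n. real n powr c)" using assms by real_asymp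
    finally show "(\<lambda>n. harm n - ln (real n)) \<in> O(\<lambda>n. real n powr c)" .
    show "(\<lambda>n. ln (real n)) \<in> O(\<lambda>n. real n powr c)" using assms by real_asymp
  qed
  thus ?thesis by simp
qed

section \<open>Expansions in powers of harmonic numbers\<close>

text \<open>Expanding in \<open>harm n\<close> instead of log n makes the increments of the main
  terms exact rational expressions, which suits induction on the index. Degree two suffices for the
  indices that occur, and the weak error rate leaves room to absorb powers of the logarithm.\<close>

definition harm_asymp :: "(nat \<Rightarrow> real) \<Rightarrow> real \<Rightarrow> real \<Rightarrow> real \<Rightarrow> bool" where
  "harm_asymp f a b c \<longleftrightarrow>
     (\<lambda>n. f n - (a + b * harm n + c * (harm n)\<^sup>2)) \<in> O(\<lambda>n. real n powr (-1/2))"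

text \<open>The exponents are chosen so that prepending an entry yields increments O(n^(-3/2)): the
  first bound is used after division by n^2, the second after division by n.\<close>

lemma harm_asymp_bigo:
  assumes "harm_asymp f a b c"
  shows "f \<in> O(\<lambda>n. real n powr (1/4))"
    and "(\<lambda>n. f (Suc n) - f n) \<in> O(\<lambda>n. real n powr (-1/2))"
proof -
  define e where "e n = f n - (a + b * harm n + c * (harm n)\<^sup>2)" for n
  have e: "e \<in> O(\<lambda>n. real n powr (-1/2))" using assms by (simp add: harm_asymp_def e_def[abs_def])
  have f: "f n = e n + (a + b * harm n + c * (harm n)\<^sup>2)" for n by (simp add: e_def)
  have h8: "(harm :: nat \<Rightarrow> real) \<in> O(\<lambda>n. real n powr (1/8))" by (rule harm_bigo_powr) simp
  have "(\<lambda>n. (harm n)\<^sup>2) \<in> O(\<lambda>n. (real n powr (1/8))\<^sup>2)" by (intro landau_o.big_power h8)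
  also have "(\<lambda>n::nat. (real n powr (1/8))\<^sup>2) \<in> O(\<lambda>n. real n powr (1/4))" by real_asymp
  finally have h2: "(\<lambda>n. (harm n)\<^sup>2) \<in> O(\<lambda>n. real n powr (1/4))" .
  have h1: "(harm :: nat \<Rightarrow> real) \<in> O(\<lambda>n. real n powr (1/4))" by (rule harm_bigo_powr) simp
  have e4: "e \<in> O(\<lambda>n. real n powr (1/4))" by (rule landau_o.big_trans[OF e]) real_asymp
  have c4: "(\<lambda>_. a) \<in> O(\<lambda>n. real n powr (1/4))" by (cases "a = 0") real_asymp+
  show "f \<in> O(\<lambda>n. real n powr (1/4))"
    unfolding f[abs_def] by (intro sum_in_bigo e4 c4 cmult_in_bigo_iff[THEN iffD2] disjI2 h1 h2)
  have "(\<lambda>n. e (Suc n)) \<in> O(\<lambda>n. real (Suc n) powr (-1/2))"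
    using landau_o.big.compose[OF e filterlim_Suc] .
  also have "(\<lambda>n. real (Suc n) powr (-1/2)) \<in> O(\<lambda>n. real n powr (-1/2))" by real_asymp
  finally have eS: "(\<lambda>n. e (Suc n)) \<in> O(\<lambda>n. real n powr (-1/2))" .
  have "(\<lambda>n. harm n * (1 / (real n + 1))) \<in> O(\<lambda>n. real n powr (1/4) * (1 / (real n + 1)))"
    by (intro landau_o.big_mult h1) auto
  also have "(\<lambda>n::nat. real n powr (1/4) * (1 / (real n + 1))) \<in> O(\<lambda>n. real n powr (-1/2))"
    by real_asymp
  finally have hd: "(\<lambda>n. harm n * (1 / (real n + 1))) \<in> O(\<lambda>n. real n powr (-1/2))" .
  have d1: "(\<lambda>n. 1 / (real n + 1)) \<in> O(\<lambda>n. real n powr (-1/2))" by real_asymp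
  have d2: "(\<lambda>n. 1 / (real n + 1)\<^sup>2) \<in> O(\<lambda>n. real n powr (-1/2))" by real_asymp
  have "f (Suc n) - f n = e (Suc n) - e n + b * (1 / (real n + 1))
      + (2 * c) * (harm n * (1 / (real n + 1))) + c * (1 / (real n + 1)\<^sup>2)" for n
    by (simp add: f harm_Suc inverse_eq_divide power2_sum power_divide algebra_simps)
  thus "(\<lambda>n. f (Suc n) - f n) \<in> O(\<lambda>n. real n powr (-1/2))"
    by (simp only:) (intro sum_in_bigo e eS cmult_in_bigo_iff[THEN iffD2] disjI2 hd d1 d2)
qed

lemma zetaM_Suc:
  "zetaM ((s, z) # r) (Suc M) = zetaM ((s, z) # r) M + z ^ Suc M / real (Suc M) ^ s * zetaM r M"
  by simp

lemma harm_asymp_zetaM_ge2: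
  assumes "harm_asymp (zetaM r) a b c" "s \<ge> 2" "\<bar>z\<bar> = 1"
  obtains a' where "harm_asymp (zetaM ((s, z) # r)) a' 0 0"
proof -
  have "(\<lambda>n. z ^ Suc n / real (Suc n) ^ s) \<in> O(\<lambda>n. real n powr (-2))"
  proof -
    have "(\<lambda>n. z ^ Suc n / real (Suc n) ^ s) \<in> O(\<lambda>n. 1 / real (Suc n) ^ 2)"
    proof (rule landau_o.bigI[of 1])
      show "\<forall>\<^sub>F n in sequentially. norm (z ^ Suc n / real (Suc n) ^ s) \<le> 1 * norm (1 / real (Suc n) ^ 2)"
      proof (intro always_eventually allI)
        fix n
        have "real (Suc n) ^ 2 \<le> real (Suc n) ^ s" using assms by (intro power_increasing) auto
        thus "norm (z ^ Suc n / real (Suc n) ^ s) \<le> 1 * norm (1 / real (Suc n) ^ 2)"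
          using assms by (auto simp: norm_divide norm_power power_abs abs_mult intro!: divide_left_mono simp del: power_Suc of_nat_Suc)
      qed
    qed auto
    also have "(\<lambda>n. 1 / real (Suc n) ^ 2) \<in> O(\<lambda>n. real n powr (-2))" by real_asymp
    finally show ?thesis .
  qed
  hence "(\<lambda>n. z ^ Suc n / real (Suc n) ^ s * zetaM r n) \<in> O(\<lambda>n. real n powr (-2) * real n powr (1/4))"
    by (intro landau_o.big_mult harm_asymp_bigo(1)[OF assms(1)])
  also have "(\<lambda>n. real n powr (-2) * real n powr (1/4)) \<in> O(\<lambda>n. real n powr (-3/2))" by real_asymp
  finally have "(\<lambda>n. zetaM ((s, z) # r) (Suc n) - zetaM ((s, z) # r) n) \<in> O(\<lambda>n. real n powr (-3/2))"
    unfolding zetaM_Suc by simp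
  from convergent_rate_of_increments[OF this] obtain a' where
    "(\<lambda>n. zetaM ((s, z) # r) n - a') \<in> O(\<lambda>n. real n powr (-1/2))" .
  thus ?thesis by (intro that[of a']) (simp add: harm_asymp_def)
qed

lemma harm_asymp_zetaM_alt:
  assumes "harm_asymp (zetaM r) a b c"
  obtains a' where "harm_asymp (zetaM ((1, -1) # r)) a' 0 0"
proof -
  define f where "f = zetaM r"
  \<comment> \<open>Averaging consecutive partial sums replaces the terms of the series by their differences.\<close>
  define A where "A n = f n / (2 * (real n + 1))" for n
  define S where "S n = zetaM ((1, -1) # r) n - (-1) ^ n * A n" for n
  note f = harm_asymp_bigo[OF assms, folded f_def]
  have *: "S (Suc n) - S n = (-1) ^ Suc n * (f n * (1 / (2 * (real n + 1) * (real n + 2)))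
             - (f (Suc n) - f n) * (1 / (2 * (real n + 2))))" for n
    by (simp add: S_def zetaM_Suc f_def[symmetric] A_def del: zetaM.simps) (simp add: divide_simps, algebra)
  have "(\<lambda>n. f n * (1 / (2 * (real n + 1) * (real n + 2)))) \<in>
        O(\<lambda>n. real n powr (1/4) * (1 / (2 * (real n + 1) * (real n + 2))))"
    by (intro landau_o.big_mult f) auto
  also have "(\<lambda>n. real n powr (1/4) * (1 / (2 * (real n + 1) * (real n + 2)))) \<in> O(\<lambda>n. real n powr (-3/2))"
    by real_asymp
  finally have 1: "(\<lambda>n. f n * (1 / (2 * (real n + 1) * (real n + 2)))) \<in> O(\<lambda>n. real n powr (-3/2))" .
  have "(\<lambda>n. (f (Suc n) - f n) * (1 / (2 * (real n + 2)))) \<in>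
        O(\<lambda>n. real n powr (-1/2) * (1 / (2 * (real n + 2))))"
    by (intro landau_o.big_mult f) auto
  also have "(\<lambda>n. real n powr (-1/2) * (1 / (2 * (real n + 2)))) \<in> O(\<lambda>n. real n powr (-3/2))"
    by real_asymp
  finally have 2: "(\<lambda>n. (f (Suc n) - f n) * (1 / (2 * (real n + 2)))) \<in> O(\<lambda>n. real n powr (-3/2))" .
  have sgn: "(\<lambda>n. (-1) ^ Suc n) \<in> O(\<lambda>_::nat. 1::real)"
    by (rule landau_o.bigI[of 1]) (auto simp: norm_power power_abs)
  have "(\<lambda>n. S (Suc n) - S n) \<in> O(\<lambda>n. 1 * real n powr (-3/2))"
    unfolding * by (intro landau_o.big_mult sgn sum_in_bigo 1 2)
  hence "(\<lambda>n. S (Suc n) - S n) \<in> O(\<lambda>n. real n powr (-3/2))" by simp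
  from convergent_rate_of_increments[OF this] obtain a' where
    a': "(\<lambda>n. S n - a') \<in> O(\<lambda>n. real n powr (-1/2))" .
  \<comment> \<open>The averaging correction is of order n^(-3/4), so it disappears in the error
    term and does not change the limit.\<close>
  have "(\<lambda>n. (-1) ^ Suc n * (f n * (1 / (2 * (real n + 1))))) \<in> O(\<lambda>n. 1 * (real n powr (1/4) * (1 / (2 * (real n + 1)))))"
    by (intro landau_o.big_mult f sgn) auto
  also have "(\<lambda>n. 1 * (real n powr (1/4) * (1 / (2 * (real n + 1))))) \<in> O(\<lambda>n. real n powr (-1/2))"
    by real_asymp
  finally have "(\<lambda>n. (-1) ^ Suc n * A n) \<in> O(\<lambda>n. real n powr (-1/2))" by (simp add: A_def)
  from sum_in_bigo(2)[OF a' this] have "(\<lambda>n. zetaM ((1, -1) # r) n - a') \<in> O(\<lambda>n. real n powr (-1/2))"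
    by (simp add: S_def del: zetaM.simps)
  thus ?thesis by (intro that[of a']) (simp add: harm_asymp_def)
qed

text \<open>Discrete integration: \<open>(harm n)\<^sup>2\<close> has increments 2 H_n/(n+1) +
  1/(n+1)^2, so b H_n/(n+1) sums to (b/2) H_n^2 up to a convergent series. Each such step raises the
  degree by one, hence the start without a quadratic term.\<close>

lemma harm_asymp_zetaM_one:
  assumes "harm_asymp (zetaM r) a b 0"
  obtains a' where "harm_asymp (zetaM ((1, 1) # r)) a' a (b / 2)"
proof -
  define e where "e n = zetaM r n - (a + b * harm n)" for n
  have e: "e \<in> O(\<lambda>n. real n powr (-1/2))" using assms by (simp add: harm_asymp_def e_def[abs_def])
  define S where "S n = zetaM ((1, 1) # r) n - a * harm n - b / 2 * (harm n)\<^sup>2" for n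
  have *: "S (Suc n) - S n = e n * (1 / (real n + 1)) - b / 2 * (1 / (real n + 1)\<^sup>2)" for n
  proof -
    define i where "i = 1 / (real n + 1)"
    have "zetaM ((1, 1) # r) (Suc n) = zetaM ((1, 1) # r) n + i * zetaM r n"
      unfolding zetaM_Suc by (simp add: i_def add.commute)
    moreover have "harm (Suc n) = harm n + i"
      by (simp add: harm_Suc i_def inverse_eq_divide add.commute)
    moreover have "1 / (real n + 1)\<^sup>2 = i\<^sup>2" by (simp add: i_def power_divide)
    ultimately show ?thesis unfolding S_def e_def i_def[symmetric]
      by (simp add: algebra_simps power2_eq_square)
  qed
  have "(\<lambda>n. e n * (1 / (real n + 1))) \<in> O(\<lambda>n. real n powr (-1/2) * (1 / (real n + 1)))"
    by (intro landau_o.big_mult e) auto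
  also have "(\<lambda>n. real n powr (-1/2) * (1 / (real n + 1))) \<in> O(\<lambda>n. real n powr (-3/2))"
    by real_asymp
  finally have 1: "(\<lambda>n. e n * (1 / (real n + 1))) \<in> O(\<lambda>n. real n powr (-3/2))" .
  have 2: "(\<lambda>n. 1 / (real n + 1)\<^sup>2) \<in> O(\<lambda>n. real n powr (-3/2))" by real_asymp
  have "(\<lambda>n. S (Suc n) - S n) \<in> O(\<lambda>n. real n powr (-3/2))"
    unfolding * by (intro sum_in_bigo 1 cmult_in_bigo_iff[THEN iffD2] disjI2 2)
  from convergent_rate_of_increments[OF this] obtain a' where
    "(\<lambda>n. S n - a') \<in> O(\<lambda>n. real n powr (-1/2))" .
  thus ?thesis by (intro that[of a']) (simp add: harm_asymp_def S_def algebra_simps del: zetaM.simps)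
qed

lemma harm_asymp_Nil: "harm_asymp (zetaM []) 1 0 0"
  by (simp add: harm_asymp_def)

section \<open>Uniqueness and evaluation of regularized values\<close>

lemma poly_tendsto_0_imp_eq_0:
  fixes P :: "real poly"
  assumes "((\<lambda>x. poly P (f x)) \<longlongrightarrow> 0) F" "filterlim f at_top F" "F \<noteq> bot"
  shows "P = 0"
proof -
  have "degree P = 0"
  proof (rule ccontr)
    assume "degree P \<noteq> 0"
    hence "filterlim (poly P) at_infinity at_infinity" by (intro filterlim_poly_at_infinity) auto
    hence "filterlim (\<lambda>x. poly P (f x)) at_infinity F"
      by (rule filterlim_compose) (rule filterlim_at_top_imp_at_infinity[OF assms(2)])
    with assms show False using not_tendsto_and_filterlim_at_infinity by blast
  qed
  then obtain c where "P = [:c:]" by (auto elim: degree_eq_zeroE)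
  moreover from this assms(1) have "((\<lambda>_. c) \<longlongrightarrow> 0) F" by simp
  hence "c = 0" using assms(3) by (simp add: tendsto_const_iff)
  ultimately show ?thesis by simp
qed

text \<open>Resolves the definite description in both regularizations, with \<open>f\<close> being
  log M + gamma or -log epsilon. Two candidates differ by a polynomial that tends to 0 along
  \<open>f\<close>, hence by the zero polynomial.\<close>

lemma the_poly_asymp:
  fixes P :: "real poly"
  assumes "((\<lambda>x. g x - poly P (f x)) \<longlongrightarrow> 0) F" "filterlim f at_top F" "F \<noteq> bot"
  shows "(THE P. ((\<lambda>x. g x - poly P (f x)) \<longlongrightarrow> 0) F) = P"
proof (rule the_equality)
  show "((\<lambda>x. g x - poly P (f x)) \<longlongrightarrow> 0) F" by fact
next
  fix Q assume "((\<lambda>x. g x - poly Q (f x)) \<longlongrightarrow> 0) F"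
  from tendsto_diff[OF assms(1) this] have "((\<lambda>x. poly (Q - P) (f x)) \<longlongrightarrow> 0) F" by simp
  from poly_tendsto_0_imp_eq_0[OF this assms(2,3)] show "Q = P" by simp
qed

lemma ln_plus_gamma_at_top: "filterlim (\<lambda>M. ln (real M) + euler_mascheroni) at_top sequentially"
  by real_asymp

lemma harm_minus_ln_bigo:
  "(\<lambda>n. harm n - (ln (real n) + euler_mascheroni)) \<in> O(\<lambda>n. 1 / real n)"
proof -
  have "(\<lambda>n. (harm n - ln (real (Suc n)) - euler_mascheroni) + (ln (real (Suc n)) - ln (real n))) \<in> O(\<lambda>n. 1 / real n)"
  proof (rule sum_in_bigo)
    show "(\<lambda>n. harm n - ln (real (Suc n)) - euler_mascheroni) \<in> O(\<lambda>n. 1 / real n)"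
    proof (rule landau_o.bigI[of 1])
      show "\<forall>\<^sub>F n in sequentially. norm (harm n - ln (real (Suc n)) - euler_mascheroni) \<le> 1 * norm (1 / real n)"
        using eventually_ge_at_top[of 1]
      proof eventually_elim
        case (elim n)
        have "inverse (real (2 * (n + 1))) \<ge> 0" "inverse (real (2 * n)) \<le> 1 / real n"
          using elim by (auto simp: field_simps)
        moreover have "inverse (real (2 * (n + 1))) \<le> 1 / real n" using elim by (auto simp: field_simps)
        moreover have "1 / real n \<ge> 0" by simp
        ultimately show ?case using euler_mascheroni_bounds[OF elim]
          unfolding atLeastAtMost_iff real_norm_def mult_1 abs_of_nonneg[OF \<open>1 / real n \<ge> 0\<close>] by linarith
      qed
    qed auto
    show "(\<lambda>n. ln (real (Suc n)) - ln (real n)) \<in> O(\<lambda>n. 1 / real n)" by real_asymp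
  qed
  thus ?thesis by (simp add: algebra_simps)
qed

lemma bigo_powr_neg_imp_tendsto_0:
  fixes f :: "nat \<Rightarrow> real"
  assumes "f \<in> O(\<lambda>n. real n powr c)" "c < 0"
  shows "f \<longlonglongrightarrow> 0"
proof -
  have "(\<lambda>n. real n powr c) \<in> o(\<lambda>_. 1)" using assms(2) by real_asymp
  from landau_o.big_small_trans[OF assms(1) this] show ?thesis
    by (simp add: smallo_def smalloD_tendsto[of f _ "\<lambda>_. 1", simplified])
qed

text \<open>Replacing H by l = log n + gamma costs O(1/n) in the linear term. In the quadratic term
  H^2 - l^2 = (H - l)(H + l), and the slow growth of the second factor is harmless.\<close>

lemma harm_asymp_tendsto:
  assumes "harm_asymp f a b c"
  shows "(\<lambda>M. f M - poly [:a, b, c:] (ln (real M) + euler_mascheroni)) \<longlonglongrightarrow> 0"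
proof -
  define l where "l n = ln (real n) + (euler_mascheroni :: real)" for n
  have d: "(\<lambda>n. harm n - l n) \<in> O(\<lambda>n. 1 / real n)"
    using harm_minus_ln_bigo by (simp add: l_def)
  have d': "(\<lambda>n. harm n - l n) \<in> O(\<lambda>n. real n powr (-1/2))"
    by (rule landau_o.big_trans[OF d]) real_asymp
  have "(\<lambda>n. (harm n - l n) * (harm n + l n)) \<in> O(\<lambda>n. 1 / real n * real n powr (1/4))"
    by (intro landau_o.big_mult d sum_in_bigo harm_bigo_powr) (simp, unfold l_def, real_asymp)
  also have "(\<lambda>n. 1 / real n * real n powr (1/4)) \<in> O(\<lambda>n. real n powr (-1/2))" by real_asymp
  finally have p: "(\<lambda>n. (harm n - l n) * (harm n + l n)) \<in> O(\<lambda>n. real n powr (-1/2))" .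
  have "(\<lambda>n. (f n - (a + b * harm n + c * (harm n)\<^sup>2)) + b * (harm n - l n)
           + c * ((harm n - l n) * (harm n + l n))) \<in> O(\<lambda>n. real n powr (-1/2))"
    using assms unfolding harm_asymp_def
    by (intro sum_in_bigo(1) cmult_in_bigo_iff[THEN iffD2] disjI2 d' p)
  hence "(\<lambda>n. f n - poly [:a, b, c:] (l n)) \<in> O(\<lambda>n. real n powr (-1/2))"
    by (simp add: algebra_simps power2_eq_square)
  thus ?thesis unfolding l_def by (rule bigo_powr_neg_imp_tendsto_0) simp
qed

lemma zeta_st_eqI:
  assumes "harm_asymp (zetaM idx) a b c"
  shows "zeta_st idx = [:a, b, c:]"
  unfolding zeta_st_def
  by (rule the_poly_asymp[OF harm_asymp_tendsto[OF assms] ln_plus_gamma_at_top]) simp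

lemma zetaM_minus_zeta_st_tendsto:
  assumes "harm_asymp (zetaM idx) a b c"
  shows "(\<lambda>M. zetaM idx M - poly (zeta_st idx) (ln (real M) + euler_mascheroni)) \<longlonglongrightarrow> 0"
  unfolding zeta_st_eqI[OF assms] by (rule harm_asymp_tendsto[OF assms])

lemma euler_zeta_LIMSEQ:
  assumes "harm_asymp (zetaM idx) a 0 0"
  shows "zetaM idx \<longlonglongrightarrow> euler_zeta idx" "euler_zeta idx = a"
proof -
  have "(\<lambda>M. zetaM idx M - a) \<longlonglongrightarrow> 0" using harm_asymp_tendsto[OF assms] by simp
  hence *: "zetaM idx \<longlonglongrightarrow> a" by (simp add: LIM_zero_iff)
  thus "euler_zeta idx = a" by (simp add: euler_zeta_def limI)
  with * show "zetaM idx \<longlonglongrightarrow> euler_zeta idx" by simp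
qed

lemma zc_eq_zeta_st:
  assumes "harm_asymp (zetaM idx) a 0 0"
  shows "zc idx = zeta_st idx"
  using zeta_st_eqI[OF assms] euler_zeta_LIMSEQ(2)[OF assms] by (simp add: zc_def)

section \<open>Iterated integrals and Abel summation\<close>

lemma summable_powser_bounded:
  fixes c :: "nat \<Rightarrow> real"
  assumes "\<And>n. \<bar>c n\<bar> \<le> B" "\<bar>x\<bar> < 1"
  shows "summable (\<lambda>n. \<bar>c n * x ^ n\<bar>)"
proof (rule summable_comparison_test')
  show "summable (\<lambda>n. B * \<bar>x\<bar> ^ n)" using assms(2) by (intro summable_mult summable_geometric) simp
  show "norm \<bar>c n * x ^ n\<bar> \<le> B * \<bar>x\<bar> ^ n" if "n \<ge> 0" for n
    using assms(1)[of n] by (auto simp: abs_mult power_abs intro!: mult_right_mono)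
qed

lemma sums_drop_first:
  fixes f :: "nat \<Rightarrow> real"
  shows "f sums s \<Longrightarrow> (\<lambda>n. f (Suc n)) sums (s - f 0)"
  by (simp add: sums_Suc_iff)

text \<open>Summation by parts gives (sum of a_n x^n) - s = (1 - x) (sum of S_n x^n), where S_n is
  the n-th partial sum minus s. As S_n tends to 0, the head is killed by the factor 1 - x and the
  tail is at most e/2.\<close>

lemma Abel_limit:
  fixes a :: "nat \<Rightarrow> real"
  assumes "a sums s"
  shows "((\<lambda>x. \<Sum>n. a n * x ^ n) \<longlongrightarrow> s) (at_left 1)"
proof -
  define S where "S n = (\<Sum>k<Suc n. a k) - s" for n
  have S0: "S \<longlonglongrightarrow> 0"
    using LIMSEQ_Suc[OF assms[unfolded sums_def]] unfolding S_def by (simp add: LIM_zero_iff del: sum.lessThan_Suc)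
  then obtain B where B: "\<And>n. \<bar>S n\<bar> \<le> B" 
    using convergent_imp_Bseq[of S] by (auto simp: convergent_def Bseq_def)
  obtain B' where B': "\<And>n. \<bar>a n\<bar> \<le> B'"
    using convergent_imp_Bseq[of a] summable_LIMSEQ_zero[OF sums_summable[OF assms]]
    by (auto simp: convergent_def Bseq_def)
  have eq: "(\<Sum>n. a n * x ^ n) - s = (1 - x) * (\<Sum>n. S n * x ^ n)" if "x > 0" "x < 1" for x
  proof -
    have sS: "summable (\<lambda>n. S n * x ^ n)"
      using summable_powser_bounded[OF B, of x] that by (simp add: summable_rabs_cancel)
    have sa: "summable (\<lambda>n. a n * x ^ n)"
      using summable_powser_bounded[OF B', of x] that by (simp add: summable_rabs_cancel)
    have "(\<lambda>n. S (Suc n) * x ^ Suc n - S n * x ^ n * x) sums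
        ((\<Sum>n. S n * x ^ n) - S 0 * x ^ 0 - (\<Sum>n. S n * x ^ n) * x)"
      by (intro sums_diff sums_mult2 summable_sums[OF sS] sums_drop_first[OF summable_sums[OF sS]])
    hence "(\<lambda>n. a (Suc n) * x ^ Suc n) sums ((\<Sum>n. S n * x ^ n) - S 0 - (\<Sum>n. S n * x ^ n) * x)"
      by (simp add: S_def algebra_simps)
    moreover have "(\<lambda>n. a (Suc n) * x ^ Suc n) sums ((\<Sum>n. a n * x ^ n) - a 0)"
      using sums_drop_first[OF summable_sums[OF sa]] by simp
    ultimately have "(\<Sum>n. a n * x ^ n) - a 0 = (\<Sum>n. S n * x ^ n) - S 0 - (\<Sum>n. S n * x ^ n) * x"
      by (rule sums_unique2[symmetric])
    moreover have "S 0 = a 0 - s" by (simp add: S_def)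
    ultimately show ?thesis by (simp add: algebra_simps)
  qed
  have "((\<lambda>x. (\<Sum>n. a n * x ^ n) - s) \<longlongrightarrow> 0) (at_left 1)"
  proof (rule tendstoI)
    fix e :: real assume e: "e > 0"
    from S0 e have "eventually (\<lambda>n. \<bar>S n\<bar> < e / 2) sequentially"
      using tendstoD[OF S0, of "e/2"] by simp
    then obtain N where N: "\<And>n. n \<ge> N \<Longrightarrow> \<bar>S n\<bar> < e / 2" by (auto simp: eventually_sequentially)
    define C where "C = (\<Sum>n<N. \<bar>S n\<bar>)"
    have "((\<lambda>x. (1 - x) * C) \<longlongrightarrow> (1 - 1) * C) (at_left 1)" by (intro tendsto_intros)
    hence "eventually (\<lambda>x. (1 - x) * C < e / 2) (at_left 1)"
      using e by (intro order_tendstoD(2)) auto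
    moreover have "eventually (\<lambda>x. x \<in> {0<..<1}) (at_left (1::real))"
      by (rule eventually_at_leftI[of 0]) auto
    ultimately show "eventually (\<lambda>x. dist ((\<Sum>n. a n * x ^ n) - s) 0 < e) (at_left 1)"
    proof eventually_elim
      case (elim x)
      have geo: "(\<lambda>n. e / 2 * x ^ n) sums (e / 2 * (1 / (1 - x)))"
        using elim by (intro sums_mult geometric_sums) auto
      have fin: "(\<lambda>n. if n \<in> {..<N} then \<bar>S n\<bar> else 0) sums C"
        unfolding C_def by (rule sums_If_finite_set) simp
      have sS: "summable (\<lambda>n. \<bar>S n * x ^ n\<bar>)"
        using summable_powser_bounded[OF B, of x] elim by simp
      have le: "\<bar>S n * x ^ n\<bar> \<le> (if n \<in> {..<N} then \<bar>S n\<bar> else 0) + e / 2 * x ^ n" for n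
      proof -
        have x: "0 \<le> x ^ n" "x ^ n \<le> 1" using elim by (auto intro: power_le_one)
        show ?thesis
        proof (cases "n < N")
          case True
          have "\<bar>S n\<bar> * x ^ n \<le> \<bar>S n\<bar> * 1" using x by (intro mult_left_mono) auto
          thus ?thesis using True x e by (auto simp: abs_mult intro: add_increasing2)
        next
          case False
          have "\<bar>S n\<bar> * x ^ n \<le> e / 2 * x ^ n" using N[of n] False x by (intro mult_right_mono) auto
          thus ?thesis using False x by (auto simp: abs_mult)
        qed
      qed
      have "\<bar>\<Sum>n. S n * x ^ n\<bar> \<le> (\<Sum>n. \<bar>S n * x ^ n\<bar>)" using sS by (rule summable_rabs)
      also have "\<dots> \<le> C + e / 2 * (1 / (1 - x))"
        by (rule sums_le[OF le summable_sums[OF sS] sums_add[OF fin geo]])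
      finally have "(1 - x) * \<bar>\<Sum>n. S n * x ^ n\<bar> \<le> (1 - x) * (C + e / 2 * (1 / (1 - x)))"
        using elim by (intro mult_left_mono) auto
      also have "\<dots> = (1 - x) * C + e / 2" using elim by (simp add: field_simps)
      also have "\<dots> < e" using elim by simp
      finally show ?case using eq[of x] elim by (simp add: dist_real_def abs_mult)
    qed
  qed
  thus ?thesis by (simp add: LIM_zero_iff)
qed

section \<open>Power series of logarithms and of iterated integrals\<close>

text \<open>Partial fractions 1/(i (n-i)) = (1/i + 1/(n-i))/n and the symmetry i to n - i. The terms
  i = 0 and i = n vanish because division by zero gives 0.\<close>

lemma sum_inverse_products:
  "(\<Sum>i\<le>n. (1 / real i) * (1 / real (n - i))) = 2 * harm (n - 1) / real n"
proof (cases "n = 0")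
  case False
  have "(\<Sum>i\<le>n. (1 / real i) * (1 / real (n - i))) = (\<Sum>i=1..n-1. (1 / real i) * (1 / real (n - i)))"
    using False by (intro sum.mono_neutral_right) (auto simp: not_le Suc_le_eq)
  also have "\<dots> = (\<Sum>i=1..n-1. (1 / real i + 1 / real (n - i)) / real n)"
  proof (intro sum.cong refl)
    fix i assume i: "i \<in> {1..n-1}"
    hence "real (n - i) = real n - real i" "real n - real i > 0" by (auto simp: of_nat_diff)
    thus "(1 / real i) * (1 / real (n - i)) = (1 / real i + 1 / real (n - i)) / real n"
      using i False by (simp add: field_simps)
  qed
  also have "\<dots> = ((\<Sum>i=1..n-1. 1 / real i) + (\<Sum>i=1..n-1. 1 / real (n - i))) / real n"
    by (simp add: sum_divide_distrib sum.distrib add_divide_distrib)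
  also have "(\<Sum>i=1..n-1. 1 / real (n - i)) = (\<Sum>i=1..n-1. 1 / real i)"
    by (rule sum.reindex_bij_witness[of _ "\<lambda>i. n - i" "\<lambda>i. n - i"]) auto
  also have "(\<Sum>i=1..n-1. 1 / real i) = harm (n - 1)" by (simp add: harm_def inverse_eq_divide)
  finally show ?thesis by simp
qed auto

text \<open>The Cauchy square of the series of -ln (1 - y), which explains the generating function
  of 2 H_(n-1)/n.\<close>

lemma harm_gen_sums:
  fixes y :: real
  assumes "\<bar>y\<bar> < 1"
  shows "(\<lambda>n. 2 * harm (n - 1) / real n * y ^ n) sums (\<Sum>n. 1 / real n * y ^ n)\<^sup>2"
proof -
  have s: "summable (\<lambda>n. norm (1 / real n * y ^ n))"
    using norm_summable_ln_series[of y] assms by simp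
  have "(\<Sum>i\<le>n. (1 / real i * y ^ i) * (1 / real (n - i) * y ^ (n - i))) = 2 * harm (n - 1) / real n * y ^ n" for n
  proof -
    have "(\<Sum>i\<le>n. (1 / real i * y ^ i) * (1 / real (n - i) * y ^ (n - i)))
        = (\<Sum>i\<le>n. (1 / real i) * (1 / real (n - i)) * y ^ n)"
    proof (intro sum.cong refl)
      fix i assume "i \<in> {..n}"
      hence "y ^ n = y ^ i * y ^ (n - i)" by (simp flip: power_add)
      thus "(1 / real i * y ^ i) * (1 / real (n - i) * y ^ (n - i)) = (1 / real i) * (1 / real (n - i)) * y ^ n"
        by simp
    qed
    also have "\<dots> = 2 * harm (n - 1) / real n * y ^ n"
      by (subst sum_inverse_products[symmetric]) (simp add: sum_distrib_right)
    finally show ?thesis .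
  qed
  with Cauchy_product_sums[OF s s] show ?thesis by (simp add: power2_eq_square)
qed

lemma minus_ln_one_minus_sums:
  fixes x :: real
  assumes "\<bar>x\<bar> < 1"
  shows "(\<lambda>n. 1 / real n * x ^ n) sums (- ln (1 - x))"
  using sums_minus[OF ln_series'[of "-x"]] assms by simp

text \<open>
  The power series coefficients of the iterated integral of a word. At \<open>n = 0\<close> the last two
  equations give \<open>0\<close> because of division by zero, as they should.
\<close>
fun word_coeff :: "real option list \<Rightarrow> nat \<Rightarrow> real" where
  "word_coeff [] n = (if n = 0 then 1 else 0)"
| "word_coeff (None # w) n = word_coeff w n / real n"
| "word_coeff (Some a # w) n = (\<Sum>k<n. word_coeff w k * a ^ (n - k)) / real n"

text \<open>Letters of modulus 1 keep the singularities of the forms on the unit circle. Excluding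
  dt/t as the innermost form makes the integral converge at 0.\<close>

definition admissible_word :: "real option list \<Rightarrow> bool" where
  "admissible_word w \<longleftrightarrow> (\<forall>a. Some a \<in> set w \<longrightarrow> \<bar>a\<bar> = 1) \<and> (w \<noteq> [] \<longrightarrow> last w \<noteq> None)"

lemma admissible_word_tl: "admissible_word (l # w) \<Longrightarrow> admissible_word w"
  by (auto simp: admissible_word_def split: if_splits)

lemma word_coeff_bound: "admissible_word w \<Longrightarrow> \<bar>word_coeff w n\<bar> \<le> 1"
proof (induction w arbitrary: n)
  case (Cons l w)
  note IH = Cons.IH[OF admissible_word_tl[OF Cons.prems]]
  show ?case
  proof (cases l)
    case None
    have "\<bar>word_coeff w n\<bar> / real n \<le> 1"
      using IH[of n] by (cases "n = 0") (auto simp: divide_simps intro: order_trans)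
    thus ?thesis using None by simp
  next
    case (Some a)
    have "\<bar>a\<bar> = 1" using Cons.prems Some by (auto simp: admissible_word_def)
    have "\<bar>\<Sum>k<n. word_coeff w k * a ^ (n - k)\<bar> \<le> (\<Sum>k<n. 1)"
      by (rule order_trans[OF sum_abs], rule sum_mono) (use IH \<open>\<bar>a\<bar> = 1\<close> in \<open>auto simp: abs_mult power_abs\<close>)
    thus ?thesis using Some by (cases "n = 0") (auto simp: divide_simps)
  qed
qed auto

lemma word_coeff_0 [simp]: "w \<noteq> [] \<Longrightarrow> word_coeff w 0 = 0"
  by (cases w; cases "hd w") auto

text \<open>Induction on the word: the candidate series \<open>g\<close> is differentiated term by
  term, its derivative is the integrand, and the fundamental theorem of calculus concludes.\<close>

lemma iterint_powser:
  assumes "admissible_word w" "0 \<le> x" "x < 1"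
  shows "iterint w x = (\<Sum>n. word_coeff w n * x ^ n)"
  using assms
proof (induction w arbitrary: x)
  case Nil
  have "(\<lambda>n. word_coeff [] n * x ^ n) sums (\<Sum>n\<in>{0}. word_coeff [] n * x ^ n)"
    by (rule sums_finite) auto
  thus ?case by (simp add: sums_iff)
next
  case (Cons l w)
  note aw = admissible_word_tl[OF Cons.prems(1)]
  define f where "f t = (\<Sum>n. word_coeff w n * t ^ n)" for t
  define g where "g t = (\<Sum>n. word_coeff (l # w) n * t ^ n)" for t
  have sf: "summable (\<lambda>n. word_coeff w n * t ^ n)" if "\<bar>t\<bar> < 1" for t
    using summable_powser_bounded[OF word_coeff_bound[OF aw] that] by (rule summable_rabs_cancel)
  have sg: "summable (\<lambda>n. word_coeff (l # w) n * t ^ n)" if "\<bar>t\<bar> < 1" for t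
    using summable_powser_bounded[OF word_coeff_bound[OF Cons.prems(1)] that] by (rule summable_rabs_cancel)
  have der: "(g has_real_derivative (\<Sum>n. diffs (word_coeff (l # w)) n * t ^ n)) (at t)" if "\<bar>t\<bar> < 1" for t
    unfolding g_def by (rule termdiffs_strong'[of 1]) (use sg that in auto)
  have sd: "summable (\<lambda>n. diffs (word_coeff (l # w)) n * t ^ n)" if "\<bar>t\<bar> < 1" for t
    by (rule termdiff_converges[of t 1]) (use sg that in auto)
  have deq: "(\<Sum>n. diffs (word_coeff (l # w)) n * t ^ n) = form l t * f t" if t: "0 < t" "t < 1" for t
  proof (cases l)
    case None
    hence "w \<noteq> []" using Cons.prems(1) by (auto simp: admissible_word_def)
    have "(\<lambda>n. word_coeff w (Suc n) * t ^ Suc n) sums f t"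
      using sums_drop_first[OF summable_sums[OF sf[of t]]] t \<open>w \<noteq> []\<close> by (simp add: f_def)
    hence "(\<lambda>n. 1 / t * (word_coeff w (Suc n) * t ^ Suc n)) sums (1 / t * f t)"
      by (rule sums_mult)
    moreover have "1 / t * (word_coeff w (Suc n) * t ^ Suc n) = diffs (word_coeff (l # w)) n * t ^ n" for n
      using t None by (simp add: diffs_def del: of_nat_Suc)
    ultimately show ?thesis using None by (simp add: sums_iff form_def)
  next
    case (Some a)
    have abs_a: "\<bar>a\<bar> = 1" using Cons.prems(1) Some by (simp add: admissible_word_def)
    hence a: "a * a = 1" by (metis abs_mult_self_eq mult_1)
    define d where "d = diffs (word_coeff (l # w))"
    have d: "d n = (\<Sum>k<Suc n. word_coeff w k * a ^ (Suc n - k))" for n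
      using Some by (simp add: d_def diffs_def del: sum.lessThan_Suc of_nat_Suc)
    \<comment> \<open>Together with \<open>dS\<close>, this says coefficient by coefficient that the
      derivative times a - t is \<open>f t\<close>. Both rest on a being its own inverse.\<close>
    have d0: "a * d 0 = word_coeff w 0" using a by (simp add: d)
    have dS: "a * d (Suc n) - d n = word_coeff w (Suc n)" for n
    proof -
      have "d (Suc n) = (\<Sum>k<Suc n. word_coeff w k * a ^ (Suc (Suc n) - k)) + word_coeff w (Suc n) * a"
        unfolding d by (subst sum.lessThan_Suc) simp
      also have "(\<Sum>k<Suc n. word_coeff w k * a ^ (Suc (Suc n) - k)) = a * d n"
        unfolding d sum_distrib_left by (intro sum.cong refl) (auto simp: Suc_diff_le less_Suc_eq_le)
      finally have "a * d (Suc n) = (a * a) * d n + (a * a) * word_coeff w (Suc n)"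
        by (simp add: algebra_simps)
      thus ?thesis using a by simp
    qed
    define D where "D = (\<Sum>n. d n * t ^ n)"
    have sD: "(\<lambda>n. d n * t ^ n) sums D" using summable_sums[OF sd[of t]] t by (simp add: D_def d_def)
    have "(\<lambda>n. a * (d (Suc n) * t ^ Suc n) - t * (d n * t ^ n)) sums (a * (D - d 0) - t * D)"
      using sums_drop_first[OF sD] by (intro sums_diff sums_mult sD) simp
    also have "(\<lambda>n. a * (d (Suc n) * t ^ Suc n) - t * (d n * t ^ n)) = (\<lambda>n. word_coeff w (Suc n) * t ^ Suc n)"
      unfolding dS[symmetric] by (rule ext) (simp add: algebra_simps)
    finally have "(\<lambda>n. word_coeff w (Suc n) * t ^ Suc n) sums (a * (D - d 0) - t * D)" .
    moreover have "(\<lambda>n. word_coeff w (Suc n) * t ^ Suc n) sums (f t - word_coeff w 0)"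
      using sums_drop_first[OF summable_sums[OF sf[of t]]] t by (simp add: f_def)
    ultimately have "a * (D - d 0) - t * D = f t - word_coeff w 0" by (rule sums_unique2)
    hence "(a - t) * D = f t" using d0 by (simp add: algebra_simps)
    moreover have "a - t \<noteq> 0"
      using t abs_a by auto
    ultimately have "D = 1 / (a - t) * f t" by (simp add: field_simps)
    thus ?thesis using Some by (simp add: D_def d_def form_def)
  qed
  have "((\<lambda>t. form l t * f t) has_integral (g x - g 0)) {0..x}"
  \<comment> \<open>The version with interior derivatives is needed because dt/t is singular at the
    endpoint 0.\<close>
  proof (rule fundamental_theorem_of_calculus_interior)
    show "continuous_on {0..x} g"
      by (intro continuous_at_imp_continuous_on ballI DERIV_isCont[OF der]) (use Cons.prems in auto)
    fix t assume "t \<in> {0<..<x}"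
    thus "(g has_vector_derivative form l t * f t) (at t)"
      using der[of t] deq[of t] Cons.prems by (simp add: has_real_derivative_iff_has_vector_derivative)
  qed (use Cons.prems in auto)
  also have "g 0 = 0"
    using powser_zero[of "word_coeff (l # w)"] by (simp add: g_def)
  finally have "integral {0..x} (\<lambda>t. form l t * f t) = g x" by (simp add: integral_unique)
  also have "integral {0..x} (\<lambda>t. form l t * f t) = integral {0..x} (\<lambda>t. form l t * iterint w t)"
    by (intro integral_cong) (use Cons.IH[OF aw] Cons.prems in \<open>auto simp: f_def\<close>)
  finally show ?case by (simp add: g_def)
qed

section \<open>Iterated integrals as generating functions of Euler sums\<close>

definition zeta_coeff :: "eindex \<Rightarrow> nat \<Rightarrow> real" where
  "zeta_coeff idx n = (if n = 0 then zetaM idx 0 else zetaM idx n - zetaM idx (n - 1))"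

lemma sum_zeta_coeff: "(\<Sum>k<Suc n. zeta_coeff idx k) = zetaM idx n"
  by (induction n) (auto simp: zeta_coeff_def simp del: zetaM.simps)

lemma word_coeff_replicate_None: "word_coeff (replicate m None @ w) n = word_coeff w n / real n ^ m"
  by (induction m) auto

definition unit_signs :: "eindex \<Rightarrow> bool" where
  "unit_signs idx \<longleftrightarrow> (\<forall>(s, z) \<in> set idx. s > 0 \<and> \<bar>z\<bar> = 1)"

text \<open>Induction on the index with the accumulated sign \<open>a\<close> generalized. The
  factors (a z)^k from the inner word and (a z)^(n-k) from the new letter combine to (a z)^n,
  leaving a sum of increments, that is, a truncated sum up to n - 1.\<close>

lemma word_coeff_word_aux:
  assumes "unit_signs idx" "\<bar>a\<bar> = 1"
  shows "word_coeff (word_aux a idx) n = a ^ n * zeta_coeff idx n"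
  using assms
proof (induction a idx arbitrary: n rule: word_aux.induct)
  case (1 a)
  thus ?case by (simp add: zeta_coeff_def)
next
  case (2 a s z r)
  have s: "s > 0" and z: "\<bar>z\<bar> = 1" "\<bar>a * z\<bar> = 1" and r: "unit_signs r"
    using 2(2,3) by (auto simp: unit_signs_def abs_mult)
  show ?case
  proof (cases n)
    case 0
    show ?thesis unfolding 0 by (simp add: word_coeff_replicate_None zeta_coeff_def)
  next
    case (Suc m)
    have "word_coeff (word_aux a ((s, z) # r)) n
        = (\<Sum>k<n. word_coeff (word_aux (a * z) r) k * (a * z) ^ (n - k)) / real n / real n ^ (s - 1)"
      by (simp add: word_coeff_replicate_None)
    also have "\<dots> = (\<Sum>k<n. word_coeff (word_aux (a * z) r) k * (a * z) ^ (n - k)) / real n ^ s"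
      using s by (cases s) auto
    also have "(\<Sum>k<n. word_coeff (word_aux (a * z) r) k * (a * z) ^ (n - k)) = (\<Sum>k<n. (a * z) ^ n * zeta_coeff r k)"
    proof (intro sum.cong refl)
      fix k assume "k \<in> {..<n}"
      hence "(a * z) ^ n = (a * z) ^ k * (a * z) ^ (n - k)" by (simp flip: power_add)
      thus "word_coeff (word_aux (a * z) r) k * (a * z) ^ (n - k) = (a * z) ^ n * zeta_coeff r k"
        using 2(1)[OF r z(2), of k] by simp
    qed
    also have "\<dots> = (a * z) ^ n * zetaM r m"
      unfolding Suc sum_distrib_left[symmetric] sum_zeta_coeff ..
    also have "\<dots> / real n ^ s = a ^ n * zeta_coeff ((s, z) # r) n"
      unfolding Suc by (simp add: zeta_coeff_def zetaM_Suc power_mult_distrib del: zetaM.simps)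
    finally show ?thesis .
  qed
qed

lemma admissible_eword: "unit_signs idx \<Longrightarrow> admissible_word (eword idx)"
proof -
  have "admissible_word (word_aux a idx)" if "unit_signs idx" "\<bar>a\<bar> = 1" for a
    using that
  proof (induction a idx rule: word_aux.induct)
    case (2 a s z r)
    hence "admissible_word (word_aux (a * z) r)" "\<bar>a * z\<bar> = 1" by (auto simp: unit_signs_def abs_mult)
    thus ?case by (auto simp: admissible_word_def)
  qed (auto simp: admissible_word_def)
  thus "unit_signs idx \<Longrightarrow> admissible_word (eword idx)" by (simp add: eword_def)
qed

lemma iterint_eword:
  assumes "unit_signs idx" "0 \<le> x" "x < 1"
  shows "iterint (eword idx) x = (\<Sum>n. zeta_coeff idx n * x ^ n)"
  using iterint_powser[OF admissible_eword[OF assms(1)] assms(2,3)]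
    word_coeff_word_aux[OF assms(1), of 1] by (simp add: eword_def)

section \<open>Comparison of the two regularizations\<close>

lemma zetaM_pl1_eq_harm: "zetaM [(1, 1)] n = harm n"
  by (simp add: harm_def inverse_eq_divide)

text \<open>The quasi-shuffle square of H_M. Its diagonal part is where the discrepancy zeta(2)
  between the two regularizations comes from.\<close>

lemma harm_square: "(harm M)\<^sup>2 = (\<Sum>k<Suc M. 2 * harm (k - 1) / real k) + zetaM [(2, 1)] M"
  by (induction M) (simp_all add: harm_Suc harm_def[of 0] power2_sum inverse_eq_divide power_divide)

lemma harm_asymp_zeta2: "harm_asymp (zetaM [(2, 1)]) (euler_zeta [pl 2]) 0 0"
  using harm_asymp_zetaM_ge2[OF harm_asymp_Nil, of 2 1] euler_zeta_LIMSEQ(2)[of "[(2,1)]"]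
  by (auto simp: pl_def simp del: zetaM.simps)

text \<open>Removing the coefficients of -b ln (1 - x) and c ln^2 (1 - x) from the generating
  function leaves a series \<open>e\<close> that converges at x = 1. By \<open>harm_square\<close>
  its sum is a + c zeta(2), and Abel's theorem makes this the constant term.\<close>

lemma zeta_sh_eqI:
  assumes idx: "unit_signs idx" and asy: "harm_asymp (zetaM idx) a b c"
  shows "zeta_sh idx = [:a + c * euler_zeta [pl 2], b, c:]"
proof -
  define e where "e n = zeta_coeff idx n - b * (1 / real n) - c * (2 * harm (n - 1) / real n)" for n
  have "(\<Sum>k<Suc M. e k) = (zetaM idx M - (a + b * harm M + c * (harm M)\<^sup>2)) + (a + c * zetaM [(2, 1)] M)" for M
  proof -
    have "(\<Sum>k<Suc M. e k) = (\<Sum>k<Suc M. zeta_coeff idx k) - b * (\<Sum>k<Suc M. 1 / real k)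
            - c * (\<Sum>k<Suc M. 2 * harm (k - 1) / real k)"
      unfolding e_def sum_subtractf sum_distrib_left ..
    also have "(\<Sum>k<Suc M. 1 / real k) = harm M"
      by (induction M) (auto simp: harm_Suc harm_def inverse_eq_divide)
    also have "(\<Sum>k<Suc M. 2 * harm (k - 1) / real k) = (harm M)\<^sup>2 - zetaM [(2, 1)] M"
      unfolding harm_square by simp
    finally show ?thesis unfolding sum_zeta_coeff by (simp add: algebra_simps)
  qed
  moreover have "(\<lambda>M. (zetaM idx M - (a + b * harm M + c * (harm M)\<^sup>2)) + (a + c * zetaM [(2, 1)] M))
      \<longlonglongrightarrow> 0 + (a + c * euler_zeta [pl 2])"
    using asy euler_zeta_LIMSEQ(1)[OF harm_asymp_zeta2]
    by (intro tendsto_intros bigo_powr_neg_imp_tendsto_0[of _ "-1/2"])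
       (auto simp: harm_asymp_def pl_def simp del: zetaM.simps)
  ultimately have "e sums (a + c * euler_zeta [pl 2])"
    unfolding sums_def by (subst filterlim_sequentially_Suc[symmetric]) (simp del: sum.lessThan_Suc)
  note lim = Abel_limit[OF this]
  have eq: "iterint (eword idx) x = b * (- ln (1 - x)) + c * (- ln (1 - x))\<^sup>2 + (\<Sum>n. e n * x ^ n)"
    if "0 < x" "x < 1" for x
  proof -
    have x: "\<bar>x\<bar> < 1" using that by simp
    note s1 = minus_ln_one_minus_sums[OF x]
    have s2: "(\<lambda>n. 2 * harm (n - 1) / real n * x ^ n) sums (- ln (1 - x))\<^sup>2"
      using harm_gen_sums[OF x] s1 by (simp add: sums_iff)
    have "summable (\<lambda>n. \<bar>word_coeff (eword idx) n * x ^ n\<bar>)"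
      by (rule summable_powser_bounded[OF word_coeff_bound[OF admissible_eword[OF idx]] x])
    hence "summable (\<lambda>n. zeta_coeff idx n * x ^ n)"
      using word_coeff_word_aux[OF idx, of 1] by (simp add: eword_def summable_rabs_cancel)
    hence s0: "(\<lambda>n. zeta_coeff idx n * x ^ n) sums iterint (eword idx) x"
      using iterint_eword[OF idx, of x] that by (simp add: sums_iff)
    have "(\<lambda>n. zeta_coeff idx n * x ^ n - b * (1 / real n * x ^ n) - c * (2 * harm (n - 1) / real n * x ^ n)) sums
      (iterint (eword idx) x - b * (- ln (1 - x)) - c * (- ln (1 - x))\<^sup>2)"
      by (intro sums_diff sums_mult s0 s1 s2)
    moreover have "zeta_coeff idx n * x ^ n - b * (1 / real n * x ^ n) - c * (2 * harm (n - 1) / real n * x ^ n)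
       = e n * x ^ n" for n
      by (simp add: e_def algebra_simps)
    ultimately show ?thesis by (simp add: sums_iff)
  qed
  have "filterlim (\<lambda>e::real. 1 - e) (at_left 1) (at_right 0)"
    by real_asymp
  from filterlim_compose[OF lim this]
  have "((\<lambda>x. (\<Sum>n. e n * (1 - x) ^ n) - (a + c * euler_zeta [pl 2])) \<longlongrightarrow> 0) (at_right 0)"
    by (simp add: LIM_zero_iff)
  moreover have "eventually (\<lambda>x. x \<in> {0<..<1}) (at_right (0::real))"
    by (rule eventually_at_rightI[of _ 1]) auto
  hence "eventually (\<lambda>x. (\<Sum>n. e n * (1 - x) ^ n) - (a + c * euler_zeta [pl 2])
      = iterint (eword idx) (1 - x) - poly [:a + c * euler_zeta [pl 2], b, c:] (- ln x)) (at_right 0)"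
  proof eventually_elim
    case (elim x)
    thus ?case using eq[of "1 - x"] by (simp add: algebra_simps power2_eq_square)
  qed
  ultimately have "((\<lambda>x. iterint (eword idx) (1 - x) - poly [:a + c * euler_zeta [pl 2], b, c:] (- ln x)) \<longlongrightarrow> 0) (at_right 0)"
    by (rule Lim_transform_eventually)
  moreover have "filterlim (\<lambda>x. - ln x :: real) at_top (at_right 0)" by real_asymp
  ultimately show ?thesis unfolding zeta_sh_def by (rule the_poly_asymp) simp
qed

section \<open>Finite identities\<close>

definition hterm :: "real \<Rightarrow> nat \<Rightarrow> real" where "hterm z n = z ^ n / real n"

definition hsum :: "real \<Rightarrow> nat \<Rightarrow> real" where "hsum z N = (\<Sum>n=1..N. hterm z n)"

definition tail_sum :: "(nat \<Rightarrow> real) \<Rightarrow> nat \<Rightarrow> nat \<Rightarrow> real" where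
  "tail_sum f q M = (\<Sum>n\<in>{q<..M}. f n)"

definition tail_sum2 :: "(nat \<Rightarrow> real) \<Rightarrow> (nat \<Rightarrow> real) \<Rightarrow> nat \<Rightarrow> nat \<Rightarrow> real" where
  "tail_sum2 f g q M = (\<Sum>n\<in>{q<..M}. f n * tail_sum g q (n - 1))"

lemma sums_LIMSEQ_Suc: "(\<lambda>M. sum f {..<Suc M}) \<longlonglongrightarrow> s \<Longrightarrow> f sums s" for f :: "nat \<Rightarrow> real"
  unfolding sums_def by (rule filterlim_sequentially_Suc[THEN iffD1])

lemma hsum_0 [simp]: "hsum z 0 = 0" by (simp add: hsum_def)

lemma hsum_Suc: "hsum z (Suc n) = hsum z n + hterm z (Suc n)" by (simp add: hsum_def)

lemma hsum_zetaM: "zetaM [(1, z)] N = hsum z N"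
  by (simp add: hsum_def hterm_def)

lemma greaterThanAtMost_split_first: "q < M \<Longrightarrow> {q<..M} = insert (Suc q) {Suc q<..M::nat}"
  by auto

lemma tail_sum_eq_0 [simp]: "M \<le> q \<Longrightarrow> tail_sum f q M = 0"
  by (simp add: tail_sum_def)

lemma tail_sum2_eq_0 [simp]: "M \<le> q \<Longrightarrow> tail_sum2 f g q M = 0"
  by (simp add: tail_sum2_def)

lemma tail_sum_step: "q < M \<Longrightarrow> tail_sum f q M = f (Suc q) + tail_sum f (Suc q) M"
  by (simp add: tail_sum_def greaterThanAtMost_split_first)

text \<open>The pairs gained by lowering the bound are those whose inner variable equals
  \<open>Suc q\<close>; the outer variable then runs over the tail beyond it.\<close>

lemma tail_sum2_step: "tail_sum2 f g q M = tail_sum2 f g (Suc q) M + g (Suc q) * tail_sum f (Suc q) M"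
proof (cases "q < M")
  case True
  have "tail_sum2 f g q M = (\<Sum>n\<in>{Suc q<..M}. f n * tail_sum g q (n - 1))"
    using True by (simp add: tail_sum2_def greaterThanAtMost_split_first)
  also have "\<dots> = (\<Sum>n\<in>{Suc q<..M}. f n * tail_sum g (Suc q) (n - 1) + g (Suc q) * f n)"
  proof (intro sum.cong refl)
    fix n assume "n \<in> {Suc q<..M}"
    hence "q < n - 1" by auto
    thus "f n * tail_sum g q (n - 1) = f n * tail_sum g (Suc q) (n - 1) + g (Suc q) * f n"
      by (simp only: tail_sum_step) (simp add: algebra_simps)
  qed
  also have "\<dots> = tail_sum2 f g (Suc q) M + g (Suc q) * tail_sum f (Suc q) M"
    by (simp add: tail_sum2_def tail_sum_def sum.distrib sum_distrib_left)
  finally show ?thesis .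
qed auto

lemma hsum_plus_tail: "q \<le> M \<Longrightarrow> hsum z q + tail_sum (hterm z) q M = hsum z M"
proof -
  assume "q \<le> M"
  hence "{1..M} = {1..q} \<union> {q<..M}" by auto
  moreover have "sum (hterm z) ({1..q} \<union> {q<..M}) = sum (hterm z) {1..q} + sum (hterm z) {q<..M}"
    by (rule sum.union_disjoint) auto
  ultimately show ?thesis by (simp add: hsum_def tail_sum_def)
qed

lemma sum_triangle_swap:
  fixes F :: "nat \<Rightarrow> nat \<Rightarrow> real"
  shows "(\<Sum>n=1..M. \<Sum>q=1..n-1. F n q) = (\<Sum>q=1..M. \<Sum>n\<in>{q<..M}. F n q)"
proof -
  have "(\<Sum>n=1..M. \<Sum>q=1..n-1. F n q) = (\<Sum>(n,q)\<in>Sigma {1..M} (\<lambda>n. {1..n-1}). F n q)"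
    by (rule sum.Sigma) auto
  also have "\<dots> = (\<Sum>(q,n)\<in>Sigma {1..M} (\<lambda>q. {q<..M}). F n q)"
    by (rule sum.reindex_bij_witness[of _ "\<lambda>(q,n). (n,q)" "\<lambda>(n,q). (q,n)"]) auto
  also have "\<dots> = (\<Sum>q=1..M. \<Sum>n\<in>{q<..M}. F n q)"
    by (rule sum.Sigma[symmetric]) auto
  finally show ?thesis .
qed

lemma zetaM_Cons: "zetaM ((s, z) # r) M = (\<Sum>n=1..M. z ^ n / real n ^ s * zetaM r (n - 1))"
  by simp

text \<open>Exchanging the order of summation makes the last variable q the outermost one. This and
  the next two lemmas bring the right-hand side into the form of a sum of e^q q^(-u)
  \<open>G\<^sub>q\<close>.\<close>

lemma zetaM_depth2:
  "zetaM [(s, z), (u, e)] M = (\<Sum>q=1..M. e ^ q / real q ^ u * tail_sum (\<lambda>n. z ^ n / real n ^ s) q M)"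
proof -
  have "zetaM [(s, z), (u, e)] M = (\<Sum>n=1..M. \<Sum>q=1..n-1. (e ^ q / real q ^ u) * (z ^ n / real n ^ s))"
    by (simp add: sum_distrib_left mult_ac)
  also have "\<dots> = (\<Sum>q=1..M. e ^ q / real q ^ u * tail_sum (\<lambda>n. z ^ n / real n ^ s) q M)"
    unfolding sum_triangle_swap by (simp add: tail_sum_def sum_distrib_left)
  finally show ?thesis .
qed

lemma zetaM_depth3_last:
  "zetaM [(1, a), (1, b), (u, e)] M = (\<Sum>q=1..M. e ^ q / real q ^ u * tail_sum2 (hterm a) (hterm b) q M)"
proof -
  have h: "(\<lambda>n. b ^ n / real n ^ 1) = hterm b" by (auto simp: hterm_def)
  have "zetaM [(1, a), (1, b), (u, e)] M
      = (\<Sum>n=1..M. \<Sum>q=1..n-1. (e ^ q / real q ^ u) * (hterm a n * tail_sum (hterm b) q (n - 1)))"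
    unfolding zetaM_Cons[of 1 a] zetaM_depth2 h
    by (simp add: sum_distrib_left mult_ac hterm_def)
  also have "\<dots> = (\<Sum>q=1..M. e ^ q / real q ^ u * tail_sum2 (hterm a) (hterm b) q M)"
    unfolding sum_triangle_swap by (simp add: tail_sum2_def sum_distrib_left)
  finally show ?thesis .
qed

lemma zetaM_depth3_middle:
  "zetaM [(1, a), (u, e), (1, b)] M = (\<Sum>q=1..M. e ^ q / real q ^ u * (hsum b (q - 1) * tail_sum (hterm a) q M))"
proof -
  have "zetaM [(1, a), (u, e), (1, b)] M
      = (\<Sum>n=1..M. \<Sum>q=1..n-1. (e ^ q / real q ^ u * hsum b (q - 1)) * hterm a n)"
    unfolding zetaM_Cons[of 1 a] zetaM_Cons[of u e] hsum_zetaM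
    by (simp add: sum_distrib_left mult_ac hterm_def)
  also have "\<dots> = (\<Sum>q=1..M. e ^ q / real q ^ u * (hsum b (q - 1) * tail_sum (hterm a) q M))"
    unfolding sum_triangle_swap by (simp add: tail_sum_def sum_distrib_left sum_distrib_right mult_ac)
  finally show ?thesis .
qed

section \<open>The sum over all splittings of the weight\<close>

text \<open>A geometric progression with ratio q/p; \<open>Suc u\<close> is the v of the
  theorem.\<close>

lemma geometric_partial_fractions:
  fixes p q :: real
  assumes "p \<noteq> 0" "q \<noteq> 0" "p \<noteq> q"
  shows "(\<Sum>b=1..u. 1 / (p ^ b * q ^ (Suc u - b))) = (1 / q ^ u - 1 / p ^ u) / (p - q)"
proof (induction u)
  case (Suc u)
  have "(\<Sum>b=1..Suc u. 1 / (p ^ b * q ^ (Suc (Suc u) - b)))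
      = (\<Sum>b=1..u. 1 / (p ^ b * q ^ (Suc (Suc u) - b))) + 1 / (p ^ Suc u * q)"
    by simp
  also have "(\<Sum>b=1..u. 1 / (p ^ b * q ^ (Suc (Suc u) - b))) = (\<Sum>b=1..u. 1 / (p ^ b * q ^ (Suc u - b))) / q"
    unfolding sum_divide_distrib by (intro sum.cong refl) (auto simp: Suc_diff_le)
  also have "\<dots> = (1 / q ^ u - 1 / p ^ u) / (p - q) / q" unfolding Suc.IH ..
  also have "\<dots> + 1 / (p ^ Suc u * q) = (1 / q ^ Suc u - 1 / p ^ Suc u) / (p - q)"
    using assms by (simp add: divide_simps) (simp add: algebra_simps)
  finally show ?case .
qed simp

text \<open>After the partial fractions with denominator p - q, the part with q^(-u) is summed over
  m = p - q, giving a harmonic sum of length N - q. In the part with p^(-u), q is replaced by p - q,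
  which gives the double sum that is subtracted.\<close>

lemma sum_depth2_weight:
  assumes z: "z2\<^sup>2 = 1" "z3\<^sup>2 = 1"
  shows "(\<Sum>b=1..u. zetaM [(b, z2), (Suc u - b, z3)] N)
       = (\<Sum>q=1..N. (z2 * z3) ^ q / real q ^ u * hsum z2 (N - q)) - zetaM [(u, z2 * z3), (1, z3)] N"
proof -
  have "(\<Sum>b=1..u. zetaM [(b, z2), (Suc u - b, z3)] N)
      = (\<Sum>b=1..u. \<Sum>p=1..N. \<Sum>q=1..p-1. z2 ^ p * z3 ^ q * (1 / (real p ^ b * real q ^ (Suc u - b))))"
    by (simp add: sum_distrib_left)
  also have "\<dots> = (\<Sum>p=1..N. \<Sum>q=1..p-1. z2 ^ p * z3 ^ q * (\<Sum>b=1..u. 1 / (real p ^ b * real q ^ (Suc u - b))))"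
    unfolding sum_distrib_left
    by (rule trans[OF sum.swap], rule sum.cong[OF refl], rule sum.swap)
  also have "\<dots> = (\<Sum>p=1..N. \<Sum>q=1..p-1. z2 ^ p * z3 ^ q / real q ^ u / real (p - q)
                     - z2 ^ p / real p ^ u * (z3 ^ q / real (p - q)))"
  proof (intro sum.cong refl)
    fix p q assume "p \<in> {1..N}" "q \<in> {1..p-1}"
    hence ne: "real p \<noteq> 0" "real q \<noteq> 0" "real p \<noteq> real q" and d: "real (p - q) = real p - real q"
      by auto
    show "z2 ^ p * z3 ^ q * (\<Sum>b=1..u. 1 / (real p ^ b * real q ^ (Suc u - b)))
        = z2 ^ p * z3 ^ q / real q ^ u / real (p - q) - z2 ^ p / real p ^ u * (z3 ^ q / real (p - q))"
      unfolding d geometric_partial_fractions[OF ne] by (simp add: diff_divide_distrib right_diff_distrib)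
  qed
  also have "\<dots> = (\<Sum>p=1..N. \<Sum>q=1..p-1. z2 ^ p * z3 ^ q / real q ^ u / real (p - q))
                - (\<Sum>p=1..N. z2 ^ p / real p ^ u * (\<Sum>q=1..p-1. z3 ^ q / real (p - q)))"
    by (simp add: sum_subtractf sum_distrib_left)
  also have "(\<Sum>p=1..N. \<Sum>q=1..p-1. z2 ^ p * z3 ^ q / real q ^ u / real (p - q))
      = (\<Sum>q=1..N. (z2 * z3) ^ q / real q ^ u * hsum z2 (N - q))"
    unfolding sum_triangle_swap
  proof (intro sum.cong refl)
    fix q assume "q \<in> {1..N}"
    have "(\<Sum>p\<in>{q<..N}. z2 ^ p * z3 ^ q / real q ^ u / real (p - q))
        = (\<Sum>m=1..N-q. (z2 * z3) ^ q / real q ^ u * hterm z2 m)"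
      by (rule sum.reindex_bij_witness[of _ "\<lambda>m. m + q" "\<lambda>p. p - q"])
         (auto simp: hterm_def power_mult_distrib power_add[symmetric] mult_ac)
    thus "(\<Sum>p\<in>{q<..N}. z2 ^ p * z3 ^ q / real q ^ u / real (p - q)) = (z2 * z3) ^ q / real q ^ u * hsum z2 (N - q)"
      by (simp add: hsum_def sum_distrib_left)
  qed
  also have "(\<Sum>p=1..N. z2 ^ p / real p ^ u * (\<Sum>q=1..p-1. z3 ^ q / real (p - q))) = zetaM [(u, z2 * z3), (1, z3)] N"
    unfolding zetaM_Cons[of u] hsum_zetaM
  proof (intro sum.cong refl)
    fix p assume "p \<in> {1..N}"
    have "(\<Sum>q=1..p-1. z3 ^ q / real (p - q)) = (\<Sum>m=1..p-1. z3 ^ p * hterm z3 m)"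
    proof (rule sum.reindex_bij_witness[of _ "\<lambda>m. p - m" "\<lambda>q. p - q"])
      fix q assume "q \<in> {1..p-1}"
      \<comment> \<open>The exponents p + (p - q) and q have the same parity, so the sign z3^q can
        be rewritten as z3^p z3^(p-q).\<close>
      hence "p + (p - q) = 2 * (p - q) + q" by auto
      hence "z3 ^ p * z3 ^ (p - q) = z3 ^ (2 * (p - q) + q)" by (simp only: power_add[symmetric])
      also have "\<dots> = z3 ^ q" using z by (simp add: power_add power_mult)
      finally show "z3 ^ p * hterm z3 (p - q) = z3 ^ q / real (p - q)" by (simp add: hterm_def)
    qed auto
    hence "(\<Sum>q=1..p-1. z3 ^ q / real (p - q)) = z3 ^ p * hsum z3 (p - 1)" by (simp add: hsum_def sum_distrib_left)
    thus "z2 ^ p / real p ^ u * (\<Sum>q=1..p-1. z3 ^ q / real (p - q)) = (z2 * z3) ^ p / real p ^ u * hsum z3 (p - 1)"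
      by (simp add: power_mult_distrib)
  qed
  finally show ?thesis .
qed

text \<open>This is \<open>F\<^sub>q\<close> of the overview.\<close>

definition conv_tail :: "real \<Rightarrow> real \<Rightarrow> nat \<Rightarrow> nat \<Rightarrow> real" where
  "conv_tail z1 z2 q M = (\<Sum>n\<in>{q<..M}. hterm z1 n * hsum z2 (n - 1 - q))"

lemma sum_depth3_weight:
  assumes z: "z2\<^sup>2 = 1" "z3\<^sup>2 = 1"
  shows "(\<Sum>b=1..u. zetaM [(1, z1), (b, z2), (Suc u - b, z3)] M) + zetaM [(1, z1), (u, z2 * z3), (1, z3)] M
       = (\<Sum>q=1..M. (z2 * z3) ^ q / real q ^ u * conv_tail z1 z2 q M)"
proof -
  have "(\<Sum>b=1..u. zetaM [(1, z1), (b, z2), (Suc u - b, z3)] M)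
      = (\<Sum>n=1..M. hterm z1 n * (\<Sum>b=1..u. zetaM [(b, z2), (Suc u - b, z3)] (n - 1)))"
    unfolding zetaM_Cons[of 1 z1]
    by (subst sum.swap) (simp add: hterm_def sum_distrib_left del: zetaM.simps)
  also have "\<dots> = (\<Sum>n=1..M. \<Sum>q=1..n-1. (z2 * z3) ^ q / real q ^ u * (hterm z1 n * hsum z2 (n - 1 - q)))
       - (\<Sum>n=1..M. hterm z1 n * zetaM [(u, z2 * z3), (1, z3)] (n - 1))"
    unfolding sum_depth2_weight[OF z]
    by (simp add: right_diff_distrib sum_subtractf sum_distrib_left mult_ac del: zetaM.simps)
  also have "(\<Sum>n=1..M. hterm z1 n * zetaM [(u, z2 * z3), (1, z3)] (n - 1)) = zetaM [(1, z1), (u, z2 * z3), (1, z3)] M"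
    unfolding zetaM_Cons[of 1 z1] by (simp add: hterm_def del: zetaM.simps)
  also have "(\<Sum>n=1..M. \<Sum>q=1..n-1. (z2 * z3) ^ q / real q ^ u * (hterm z1 n * hsum z2 (n - 1 - q)))
      = (\<Sum>q=1..M. (z2 * z3) ^ q / real q ^ u * conv_tail z1 z2 q M)"
    unfolding sum_triangle_swap by (simp add: conv_tail_def sum_distrib_left)
  finally show ?thesis by simp
qed

lemma conv_tail_eq_0 [simp]: "M \<le> q \<Longrightarrow> conv_tail z1 z2 q M = 0"
  by (simp add: conv_tail_def)

text \<open>Passing from q to j = q + 1 removes the term m = n - j from each inner harmonic sum. It
  splits by 1/(n m) = (1/m - 1/n)/j, with signs z1^n z2^m = z1^j y^m = z2^j y^n.\<close>

lemma conv_tail_step: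
  fixes z1 z2 :: real
  assumes z: "z2\<^sup>2 = 1" and q: "q < M"
  defines "j \<equiv> Suc q" and "y \<equiv> z1 * z2"
  shows "conv_tail z1 z2 q M = conv_tail z1 z2 j M
      + (z1 ^ j * (hsum y M - tail_sum (hterm y) (M - j) M) - z2 ^ j * tail_sum (hterm y) j M) / real j"
proof -
  \<comment> \<open>The term n = j drops out because its inner harmonic sum is empty.\<close>
  have "conv_tail z1 z2 q M = (\<Sum>n\<in>{j<..M}. hterm z1 n * hsum z2 (n - 1 - q))"
    using q by (simp add: conv_tail_def greaterThanAtMost_split_first j_def)
  also have "\<dots> = (\<Sum>n\<in>{j<..M}. hterm z1 n * hsum z2 (n - 1 - j)
                     + (z1 ^ j * hterm y (n - j) - z2 ^ j * hterm y n) / real j)"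
  proof (intro sum.cong refl)
    fix n assume n: "n \<in> {j<..M}"
    define m where "m = n - j"
    have m: "n = m + j" "m > 0" using n by (auto simp: m_def)
    have "n - 1 - q = Suc (m - 1)" "n - 1 - j = m - 1" "Suc (m - 1) = m" using m by (auto simp: j_def)
    hence "hsum z2 (n - 1 - q) = hsum z2 (n - 1 - j) + hterm z2 m"
      using hsum_Suc[of z2 "m - 1"] by simp
    moreover have "hterm z1 n * hterm z2 m = (z1 ^ j * hterm y m - z2 ^ j * hterm y n) / real j"
    proof -
      have "z2 ^ j * z2 ^ (m + j) = z2 ^ (2 * j + m)" by (subst power_add[symmetric], rule arg_cong[of _ _ "(^) z2"]) simp
      also have "\<dots> = z2 ^ m" using z by (simp add: power_add power_mult)
      finally have "z2 ^ j * y ^ n = z1 ^ n * z2 ^ m" by (simp add: y_def power_mult_distrib m mult_ac)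
      moreover have "z1 ^ j * y ^ m = z1 ^ n * z2 ^ m" by (simp add: y_def power_mult_distrib m power_add mult_ac)
      moreover have "j > 0" by (simp add: j_def)
      ultimately have "(z1 ^ j * hterm y m - z2 ^ j * hterm y n) / real j = z1 ^ n * z2 ^ m * (1 / real m - 1 / real n) / real j"
        by (simp add: hterm_def algebra_simps)
      also have "1 / real m - 1 / real n = real j / (real m * real n)" using m by (simp add: field_simps)
      finally show ?thesis using \<open>j > 0\<close> by (simp add: hterm_def)
    qed
    ultimately show "hterm z1 n * hsum z2 (n - 1 - q) = hterm z1 n * hsum z2 (n - 1 - j)
                     + (z1 ^ j * hterm y (n - j) - z2 ^ j * hterm y n) / real j"
      by (simp add: m_def[symmetric] distrib_left)
  qed
  also have "\<dots> = conv_tail z1 z2 j M + (z1 ^ j * (\<Sum>n\<in>{j<..M}. hterm y (n - j)) - z2 ^ j * tail_sum (hterm y) j M) / real j"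
    by (simp add: conv_tail_def tail_sum_def sum.distrib sum_subtractf sum_distrib_left sum_divide_distrib[symmetric])
  also have "(\<Sum>n\<in>{j<..M}. hterm y (n - j)) = hsum y (M - j)"
    unfolding hsum_def by (rule sum.reindex_bij_witness[of _ "\<lambda>m. m + j" "\<lambda>n. n - j"]) auto
  \<comment> \<open>Completing the harmonic sum from M - j to M isolates the only part that the
    right-hand side will not match.\<close>
  also have "hsum y (M - j) = hsum y M - tail_sum (hterm y) (M - j) M"
    using hsum_plus_tail[of "M - j" M y] by simp
  finally show ?thesis .
qed

text \<open>The j terms are compared one by one with 1, 1/2, ..., 1/j. The bound does not depend on
  M, as domination requires.\<close>

lemma tail_sum_hterm_bound:
  assumes "\<bar>y\<bar> = 1" "j \<le> M"
  shows "\<bar>tail_sum (hterm y) (M - j) M\<bar> \<le> harm j"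
proof -
  have "\<bar>tail_sum (hterm y) k (k + j)\<bar> \<le> harm j" for k
  proof (induction j)
    case (Suc j)
    have "{k<..k + Suc j} = insert (k + Suc j) {k<..k + j}" by auto
    hence "tail_sum (hterm y) k (k + Suc j) = hterm y (k + Suc j) + tail_sum (hterm y) k (k + j)"
      by (simp add: tail_sum_def)
    moreover have "\<bar>hterm y (k + Suc j)\<bar> \<le> 1 / real (Suc j)"
      using assms by (auto simp: hterm_def power_abs abs_mult intro!: divide_left_mono)
    ultimately show ?case using Suc by (simp add: harm_Suc inverse_eq_divide)
  qed (simp add: harm_def)
  from this[of "M - j"] show ?thesis using assms by simp
qed

lemma tail_sum_hterm_tendsto_0:
  assumes "\<bar>y\<bar> = 1"
  shows "(\<lambda>M. tail_sum (hterm y) (M - j) M) \<longlonglongrightarrow> 0"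
proof (induction j)
  case (Suc j)
  have "(\<lambda>M. hterm y (M - j)) \<longlonglongrightarrow> 0"
  proof (rule Lim_null_comparison)
    show "\<forall>\<^sub>F M in sequentially. norm (hterm y (M - j)) \<le> 1 / (real M - real j)"
      using eventually_gt_at_top[of j]
      by eventually_elim (use assms in \<open>auto simp: hterm_def power_abs of_nat_diff\<close>)
    show "(\<lambda>M. 1 / (real M - real j)) \<longlonglongrightarrow> 0" by real_asymp
  qed
  from tendsto_add[OF this Suc] have "(\<lambda>M. hterm y (M - j) + tail_sum (hterm y) (M - j) M) \<longlonglongrightarrow> 0" by simp
  moreover have "eventually (\<lambda>M. hterm y (M - j) + tail_sum (hterm y) (M - j) M = tail_sum (hterm y) (M - Suc j) M) sequentially"
    using eventually_gt_at_top[of j]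
  proof eventually_elim
    case (elim M)
    hence "Suc (M - Suc j) = M - j" by simp
    thus ?case using elim tail_sum_step[of "M - Suc j" M "hterm y"] by simp
  qed
  ultimately show ?case by (rule Lim_transform_eventually)
qed simp

section \<open>Passage to the limit by dominated convergence\<close>

text \<open>Each increment in q tends to 0 as M grows, so every \<open>\<delta> q\<close> has the
  same limit \<open>\<kappa>\<close>. The increments are bounded by H_j/j with j = q + 1, so (B +
  H_q^2)/q^2 is a summable majorant and Tannery's theorem applies.\<close>

lemma weighted_delta_tendsto:
  fixes \<delta> :: "nat \<Rightarrow> nat \<Rightarrow> real"
  assumes z: "\<bar>z\<bar> = 1" "\<bar>y\<bar> = 1" "\<bar>e\<bar> = 1" and u: "u \<ge> 2"
    and zero: "\<And>q M. M \<le> q \<Longrightarrow> \<delta> q M = 0"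
    and step: "\<And>q M. q < M \<Longrightarrow>
      \<delta> q M - \<delta> (Suc q) M = - (z ^ Suc q * tail_sum (hterm y) (M - Suc q) M / real (Suc q))"
    and lim: "\<delta> 0 \<longlonglongrightarrow> \<kappa>"
  shows "(\<lambda>M. \<Sum>q=1..M. e ^ q / real q ^ u * \<delta> q M) \<longlonglongrightarrow> \<kappa> * euler_zeta [(u, e)]"
proof -
  obtain B where B: "\<And>M. \<bar>\<delta> 0 M\<bar> \<le> B"
    using convergent_imp_Bseq[of "\<delta> 0"] lim by (auto simp: convergent_def Bseq_def)
  have bound: "\<bar>\<delta> q M\<bar> \<le> B + (harm q)\<^sup>2" for q M
  proof (induction q)
    case 0
    show ?case using B[of M] by (simp add: add_increasing2)
  next
    case (Suc q)
    \<comment> \<open>The growth of H_q^2 leaves room for one more increment H_(q+1)/(q+1), which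
      closes the induction.\<close>
    have mono: "(harm q)\<^sup>2 + harm (Suc q) / real (Suc q) \<le> (harm (Suc q) :: real)\<^sup>2"
    proof -
      have "(harm (Suc q) :: real)\<^sup>2 - (harm q)\<^sup>2 - harm (Suc q) / real (Suc q) = harm q / real (Suc q)"
        by (simp add: harm_Suc inverse_eq_divide power2_eq_square algebra_simps add_divide_distrib)
      moreover have "harm q / real (Suc q) \<ge> (0::real)" by (simp add: harm_nonneg)
      ultimately show ?thesis by linarith
    qed
    have nn: "harm (Suc q) / real (Suc q) \<ge> (0::real)" by (simp add: harm_nonneg del: of_nat_Suc)
    show ?case
    proof (cases "q < M")
      case True
      have "\<bar>z ^ Suc q * tail_sum (hterm y) (M - Suc q) M / real (Suc q)\<bar>
          = \<bar>tail_sum (hterm y) (M - Suc q) M\<bar> / real (Suc q)"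
        using z by (simp add: abs_mult power_abs del: of_nat_Suc power_Suc)
      also have "\<dots> \<le> harm (Suc q) / real (Suc q)"
        using tail_sum_hterm_bound[OF z(2), of "Suc q" M] True by (intro divide_right_mono) auto
      finally show ?thesis using step[OF True] Suc mono by linarith
    next
      case False
      have "0 \<le> B + (harm q)\<^sup>2" using Suc by (rule order_trans[OF abs_ge_zero])
      thus ?thesis using zero[of M "Suc q"] False mono nn by simp
    qed
  qed
  have ptw: "(\<lambda>M. \<delta> q M) \<longlonglongrightarrow> \<kappa>" for q
  proof (induction q)
    case (Suc q)
    have "(\<lambda>M. \<delta> q M + z ^ Suc q * tail_sum (hterm y) (M - Suc q) M / real (Suc q)) \<longlonglongrightarrow> \<kappa> + z ^ Suc q * 0 / real (Suc q)"
      by (intro tendsto_intros Suc tail_sum_hterm_tendsto_0 z) simp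
    moreover have "eventually (\<lambda>M. \<delta> q M + z ^ Suc q * tail_sum (hterm y) (M - Suc q) M / real (Suc q) = \<delta> (Suc q) M) sequentially"
      using eventually_gt_at_top[of q] by eventually_elim (use step in \<open>force simp: algebra_simps\<close>)
    ultimately show ?case by (auto intro: Lim_transform_eventually)
  qed (rule lim)
  define c where "c q = e ^ q / real q ^ u" for q
  have c0: "c 0 = 0" using u by (simp add: c_def)
  have c_bound: "\<bar>c q\<bar> \<le> 1 / real q ^ 2" for q
  proof (cases "q = 0")
    case False
    hence "real q ^ 2 \<le> real q ^ u" using u by (intro power_increasing) auto
    thus ?thesis using False z by (auto simp: c_def power_abs intro!: divide_left_mono)
  qed (simp add: c0)
  have csum: "c sums euler_zeta [(u, e)]"
  proof -
    obtain a where "harm_asymp (zetaM [(u, e)]) a 0 0"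
      using harm_asymp_zetaM_ge2[OF harm_asymp_Nil u z(3)] .
    from euler_zeta_LIMSEQ(1)[OF this] have "zetaM [(u, e)] \<longlonglongrightarrow> euler_zeta [(u, e)]" .
    moreover have "zetaM [(u, e)] M = sum c {..<Suc M}" for M
    proof -
      have "{..<Suc M} = insert 0 {1..M}" by auto
      thus ?thesis by (simp add: c0) (simp add: c_def)
    qed
    hence "zetaM [(u, e)] = (\<lambda>M. sum c {..<Suc M})" by (rule ext)
    ultimately show ?thesis by (intro sums_LIMSEQ_Suc) (simp only:)
  qed
  have "summable (\<lambda>q. (B + (harm q)\<^sup>2) * (1 / real q ^ 2))"
  proof (rule summable_comparison_test_bigo)
    show "summable (\<lambda>n. norm (real n powr (-3/2)))" by (simp add: summable_real_powr_iff)
    have h8: "(harm :: nat \<Rightarrow> real) \<in> O(\<lambda>n. real n powr (1/8))" by (rule harm_bigo_powr) simp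
    have "(\<lambda>n. (harm n)\<^sup>2) \<in> O(\<lambda>n. (real n powr (1/8))\<^sup>2)" by (intro landau_o.big_power h8)
    also have "(\<lambda>n::nat. (real n powr (1/8))\<^sup>2) \<in> O(\<lambda>n. real n powr (1/2))" by real_asymp
    finally have "(\<lambda>n. (harm n)\<^sup>2) \<in> O(\<lambda>n. real n powr (1/2))" .
    moreover have "(\<lambda>_. B) \<in> O(\<lambda>n. real n powr (1/2))" by (cases "B = 0") real_asymp+
    ultimately have "(\<lambda>q. (B + (harm q)\<^sup>2) * (1 / real q ^ 2)) \<in> O(\<lambda>q. real q powr (1/2) * (1 / real q ^ 2))"
      by (intro landau_o.big_mult sum_in_bigo) auto
    also have "(\<lambda>q. real q powr (1/2) * (1 / real q ^ 2)) \<in> O(\<lambda>q. real q powr (-3/2))" by real_asymp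
    finally show "(\<lambda>q. (B + (harm q)\<^sup>2) * (1 / real q ^ 2)) \<in> O(\<lambda>q. real q powr (-3/2))" .
  qed
  moreover have "norm (c q * \<delta> q M) \<le> (B + (harm q)\<^sup>2) * (1 / real q ^ 2)" for q M
    using mult_mono[OF bound[of q M] c_bound[of q]] order_trans[OF abs_ge_zero bound[of q M]]
    by (simp add: abs_mult mult.commute)
  ultimately have "(\<lambda>M. \<Sum>q. c q * \<delta> q M) \<longlonglongrightarrow> (\<Sum>q. c q * \<kappa>)"
    using tannerys_theorem[where a = "\<lambda>q M. c q * \<delta> q M" and F = sequentially and b = "\<lambda>q. c q * \<kappa>"
        and M = "\<lambda>q. (B + (harm q)\<^sup>2) * (1 / real q ^ 2)"]
    by (simp add: tendsto_mult_left ptw always_eventually)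
  moreover have "(\<Sum>q. c q * \<kappa>) = \<kappa> * euler_zeta [(u, e)]"
    using sums_mult2[OF csum, of \<kappa>] by (simp add: sums_iff mult.commute)
  moreover have "(\<Sum>q. c q * \<delta> q M) = (\<Sum>q=1..M. e ^ q / real q ^ u * \<delta> q M)" for M
    by (subst suminf_finite[of "{1..M}"]) (auto simp: c_def[symmetric] c0 not_le Suc_le_eq zero)
  ultimately show ?thesis by simp
qed

section \<open>The weighted sums\<close>

text \<open>This and the next two predicates forget the coefficients and record only a bound on the
  degree in H_M, which is all that most terms require.\<close>

definition zeta_convergent :: "eindex \<Rightarrow> bool" where
  "zeta_convergent idx \<longleftrightarrow> (\<exists>a. harm_asymp (zetaM idx) a 0 0)"

definition zeta_linear :: "eindex \<Rightarrow> bool" where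
  "zeta_linear idx \<longleftrightarrow> (\<exists>a b. harm_asymp (zetaM idx) a b 0)"

definition zeta_quadratic :: "eindex \<Rightarrow> bool" where
  "zeta_quadratic idx \<longleftrightarrow> (\<exists>a b c. harm_asymp (zetaM idx) a b c)"

lemma zeta_convergent_imp_linear: "zeta_convergent idx \<Longrightarrow> zeta_linear idx"
  by (auto simp: zeta_convergent_def zeta_linear_def)

lemma zeta_linear_imp_quadratic: "zeta_linear idx \<Longrightarrow> zeta_quadratic idx"
  by (auto simp: zeta_linear_def zeta_quadratic_def)

lemma zeta_convergent_Nil: "zeta_convergent []"
  using harm_asymp_Nil by (auto simp: zeta_convergent_def)

lemma zeta_convergent_Cons_ge2:
  "zeta_quadratic r \<Longrightarrow> s \<ge> 2 \<Longrightarrow> \<bar>z\<bar> = 1 \<Longrightarrow> zeta_convergent ((s, z) # r)"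
  using harm_asymp_zetaM_ge2 unfolding zeta_quadratic_def zeta_convergent_def by metis

lemma zeta_convergent_Cons_alt: "zeta_quadratic r \<Longrightarrow> zeta_convergent ((1, -1) # r)"
  using harm_asymp_zetaM_alt unfolding zeta_quadratic_def zeta_convergent_def by metis

lemma zeta_linear_Cons_one: "zeta_convergent r \<Longrightarrow> zeta_linear ((1, 1) # r)"
proof -
  assume "zeta_convergent r"
  then obtain a where "harm_asymp (zetaM r) a 0 0" unfolding zeta_convergent_def ..
  then obtain a' where "harm_asymp (zetaM ((1, 1) # r)) a' a (0 / 2)" by (rule harm_asymp_zetaM_one)
  hence "harm_asymp (zetaM ((1, 1) # r)) a' a 0" by (simp only: div_0)
  thus ?thesis unfolding zeta_linear_def by blast
qed

lemma zeta_quadratic_Cons_one: "zeta_linear r \<Longrightarrow> zeta_quadratic ((1, 1) # r)"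
  using harm_asymp_zetaM_one unfolding zeta_linear_def zeta_quadratic_def by metis

lemma zeta_linear_single:
  assumes "s \<ge> 1" "z = 1 \<or> z = -1"
  shows "zeta_linear [(s, z)]"
proof (cases "s = 1 \<and> z = 1")
  case True
  thus ?thesis using zeta_linear_Cons_one[OF zeta_convergent_Nil] by simp
next
  case False
  hence "(s \<ge> 2 \<and> \<bar>z\<bar> = 1) \<or> (s = 1 \<and> z = -1)" using assms by auto
  hence "zeta_convergent [(s, z)]"
    using zeta_convergent_Cons_ge2[of "[]"] zeta_convergent_Cons_alt[of "[]"]
      zeta_convergent_Nil zeta_convergent_imp_linear zeta_linear_imp_quadratic by metis
  thus ?thesis by (rule zeta_convergent_imp_linear)
qed

lemma zeta_quadratic_pair:
  assumes "s \<ge> 1" "z = 1 \<or> z = -1" "t \<ge> 1" "y = 1 \<or> y = -1"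
  shows "zeta_quadratic [(s, z), (t, y)]"
    and "s \<ge> 2 \<or> z = -1 \<Longrightarrow> zeta_convergent [(s, z), (t, y)]"
    and "t \<ge> 2 \<Longrightarrow> zeta_linear [(s, z), (t, y)]"
proof -
  have l: "zeta_linear [(t, y)]" using assms by (intro zeta_linear_single)
  show c: "zeta_convergent [(s, z), (t, y)]" if "s \<ge> 2 \<or> z = -1"
  proof (cases "s \<ge> 2")
    case True
    thus ?thesis using assms by (intro zeta_convergent_Cons_ge2 zeta_linear_imp_quadratic l) auto
  next
    case False
    hence "s = 1" "z = -1" using assms that by auto
    thus ?thesis using zeta_convergent_Cons_alt[OF zeta_linear_imp_quadratic[OF l]] by simp
  qed
  have one: "s = 1 \<and> z = 1" if "\<not> (s \<ge> 2 \<or> z = -1)" using assms that by auto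
  show "zeta_quadratic [(s, z), (t, y)]"
    using c one zeta_quadratic_Cons_one[OF l] zeta_linear_imp_quadratic zeta_convergent_imp_linear by metis
  show "zeta_linear [(s, z), (t, y)]" if "t \<ge> 2"
  proof -
    have "zeta_convergent [(t, y)]"
      using that assms zeta_convergent_Cons_ge2[of "[]"] zeta_convergent_Nil zeta_convergent_imp_linear
        zeta_linear_imp_quadratic by auto
    thus ?thesis using c one zeta_linear_Cons_one zeta_convergent_imp_linear by metis
  qed
qed

lemma zeta_triple_alt:
  assumes "s \<ge> 1" "z = 1 \<or> z = -1" "t \<ge> 1" "y = 1 \<or> y = -1"
  shows "zeta_convergent [(1, -1), (s, z), (t, y)]"
  using zeta_quadratic_pair(1)[OF assms] by (rule zeta_convergent_Cons_alt)

lemma zeta_triple_one: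
  assumes "s \<ge> 1" "z = 1 \<or> z = -1" "t \<ge> 1" "y = 1 \<or> y = -1"
  shows "s \<ge> 2 \<or> z = -1 \<Longrightarrow> zeta_linear [(1, 1), (s, z), (t, y)]"
    and "s \<ge> 2 \<or> z = -1 \<or> t \<ge> 2 \<Longrightarrow> zeta_quadratic [(1, 1), (s, z), (t, y)]"
  using zeta_quadratic_pair[OF assms] zeta_linear_Cons_one zeta_quadratic_Cons_one
    zeta_convergent_imp_linear by blast+

lemma zeta_quadratic_triple:
  assumes "x = 1 \<or> x = -1" "s \<ge> 1" "z = 1 \<or> z = -1" "t \<ge> 1" "y = 1 \<or> y = -1" "s \<ge> 2 \<or> t \<ge> 2"
  shows "zeta_quadratic [(1, x), (s, z), (t, y)]"
  using assms(1)
proof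
  assume "x = 1"
  thus ?thesis using zeta_triple_one(2)[of s z t y] assms by auto
next
  assume "x = -1"
  thus ?thesis using zeta_triple_alt[of s z t y] assms zeta_convergent_imp_linear zeta_linear_imp_quadratic by auto
qed

lemma zeta_convergent_zc: "zeta_convergent idx \<Longrightarrow> zc idx = zeta_st idx"
  using zc_eq_zeta_st by (auto simp: zeta_convergent_def)

lemma zeta_convergent_LIMSEQ: "zeta_convergent idx \<Longrightarrow> zetaM idx \<longlonglongrightarrow> euler_zeta idx"
  using euler_zeta_LIMSEQ by (auto simp: zeta_convergent_def)

lemma zeta_quadratic_tendsto:
  "zeta_quadratic idx \<Longrightarrow>
     (\<lambda>M. zetaM idx M - poly (zeta_st idx) (ln (real M) + euler_mascheroni)) \<longlonglongrightarrow> 0"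
  using zetaM_minus_zeta_st_tendsto by (auto simp: zeta_quadratic_def)

text \<open>The correction is a multiple of the quadratic coefficient, which is zero here.\<close>

lemma zeta_sh_eq_zeta_st:
  assumes "zeta_linear idx" "unit_signs idx"
  shows "zeta_sh idx = zeta_st idx"
  using assms zeta_st_eqI zeta_sh_eqI by (fastforce simp: zeta_linear_def)

text \<open>Prepending 1 twice to (u, e) turns the constant zeta(u, e) into the quadratic
  coefficient zeta(u, e)/2, which the regularization multiplies by zeta(2).\<close>

lemma zeta_sh_one_one:
  assumes "u \<ge> 2" "\<bar>e\<bar> = 1"
  shows "zeta_sh [(1, 1), (1, 1), (u, e)]
       = zeta_st [(1, 1), (1, 1), (u, e)] + [:1/2 * euler_zeta [pl 2] * euler_zeta [(u, e)]:]"
proof -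
  obtain a where a: "harm_asymp (zetaM [(u, e)]) a 0 0"
    using harm_asymp_zetaM_ge2[OF harm_asymp_Nil assms] .
  obtain a' where "harm_asymp (zetaM [(1, 1), (u, e)]) a' a 0"
    using harm_asymp_zetaM_one[OF a] by auto
  then obtain a'' where a'': "harm_asymp (zetaM [(1, 1), (1, 1), (u, e)]) a'' a' (a / 2)"
    using harm_asymp_zetaM_one by blast
  have us: "unit_signs [(1, 1), (1, 1), (u, e)]" using assms by (auto simp: unit_signs_def)
  show ?thesis
    using zeta_st_eqI[OF a''] zeta_sh_eqI[OF us a''] euler_zeta_LIMSEQ(2)[OF a] by simp
qed

section \<open>Double sums of weight two\<close>

lemma hsum_alt_LIMSEQ: "hsum (-1) \<longlonglongrightarrow> euler_zeta [br 1]"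
  using zeta_convergent_LIMSEQ[OF zeta_convergent_Cons_alt, of "[]"]
    zeta_convergent_Nil zeta_convergent_imp_linear zeta_linear_imp_quadratic
  unfolding br_def hsum_zetaM by blast

lemma zeta2_LIMSEQ: "zetaM [(2, 1)] \<longlonglongrightarrow> euler_zeta [pl 2]"
  using euler_zeta_LIMSEQ(1)[OF harm_asymp_zeta2] by (simp add: pl_def)

text \<open>Up to 2M the alternating sum is twice its even part minus the whole sum, and the even
  terms add up to a quarter of the sum up to M.\<close>

lemma zeta2_alt_LIMSEQ: "zetaM [(2, -1)] \<longlonglongrightarrow> - euler_zeta [pl 2] / 2"
proof -
  have "zeta_convergent [(2, -1)]"
    using zeta_convergent_Cons_ge2[of "[]" 2 "-1"] zeta_convergent_Nil zeta_convergent_imp_linear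
      zeta_linear_imp_quadratic by simp
  note lim = zeta_convergent_LIMSEQ[OF this]
  have eq: "zetaM [(2, -1)] (2 * M) = zetaM [(2, 1)] M / 2 - zetaM [(2, 1)] (2 * M)" for M
  proof (induction M)
    case (Suc M)
    have b: "real (Suc (Suc (2 * M))) ^ 2 = 4 * real (Suc M) ^ 2" by (simp add: power2_eq_square algebra_simps)
    have "2 * Suc M = Suc (Suc (2 * M))" by simp
    thus ?case unfolding zetaM_Suc zetaM.simps(1) b
      by (simp only: zetaM_Suc zetaM.simps(1) b Suc.IH) (simp add: add_divide_distrib del: of_nat_Suc zetaM.simps)
  qed simp
  have sub: "filterlim (\<lambda>M. 2 * M) sequentially (sequentially :: nat filter)"
    by (rule filterlim_subseq) (auto simp: strict_mono_def)
  have "(\<lambda>M. zetaM [(2, 1)] M / 2 - zetaM [(2, 1)] (2 * M)) \<longlonglongrightarrow> euler_zeta [pl 2] / 2 - euler_zeta [pl 2]"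
    by (intro tendsto_intros zeta2_LIMSEQ filterlim_compose[OF zeta2_LIMSEQ sub]) auto
  moreover have "(\<lambda>M. zetaM [(2, -1)] (2 * M)) \<longlonglongrightarrow> euler_zeta [(2, -1)]"
    by (rule filterlim_compose[OF lim sub])
  ultimately have "euler_zeta [(2, -1)] = euler_zeta [pl 2] / 2 - euler_zeta [pl 2]"
    unfolding eq by (rule LIMSEQ_unique[symmetric])
  with lim show ?thesis by simp
qed

lemma zetaM_Cons_one: "zetaM ((1, z) # r) M = (\<Sum>n<Suc M. hterm z n * zetaM r (n - 1))"
proof -
  have "{..<Suc M} = insert 0 {1..M}" by auto
  thus ?thesis by (simp add: hterm_def)
qed

lemma hsum_square: "(hsum z M)\<^sup>2 = 2 * zetaM [(1, z), (1, z)] M + zetaM [(2, z\<^sup>2)] M"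
proof (induction M)
  case (Suc M)
  have h1: "z ^ Suc M / real (Suc M) ^ 1 = hterm z (Suc M)" by (simp only: hterm_def power_one_right)
  have h2: "(hterm z (Suc M))\<^sup>2 = (z\<^sup>2) ^ Suc M / real (Suc M) ^ 2"
    by (simp only: hterm_def power_divide power_mult[symmetric] mult.commute)
  show ?case
    unfolding hsum_Suc power2_sum zetaM_Suc hsum_zetaM h1 h2 Suc.IH zetaM.simps(1)
    by (simp only: distrib_left mult_1_right ac_simps)
qed simp

text \<open>Evaluating the square of the logarithm series at -x gives ln^2 (1 + x)/2 as the
  generating function of these terms. Abel's theorem on both sides then yields the value at x =
  1.\<close>

lemma zeta_alt_one_LIMSEQ: "zetaM [(1, -1), (1, 1)] \<longlonglongrightarrow> (euler_zeta [br 1])\<^sup>2 / 2"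
proof -
  define L where "L = euler_zeta [br 1]"
  define a where "a n = hterm (-1) n * harm (n - 1)" for n
  have "zeta_convergent [(1, -1), (1, 1)]"
    by (rule zeta_convergent_Cons_alt, rule zeta_linear_imp_quadratic, rule zeta_linear_single) auto
  note lim = zeta_convergent_LIMSEQ[OF this]
  have "zetaM [(1, -1), (1, 1)] = (\<lambda>M. sum a {..<Suc M})"
    unfolding a_def zetaM_pl1_eq_harm[symmetric] by (rule ext) (rule zetaM_Cons_one)
  with lim have "a sums euler_zeta [(1, -1), (1, 1)]" by (intro sums_LIMSEQ_Suc) (simp only:)
  note A = Abel_limit[OF this]
  have "hsum (-1) = (\<lambda>M. sum (hterm (-1)) {..<Suc M})"
    by (rule ext, unfold hsum_zetaM[symmetric] zetaM_Cons_one) simp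
  with hsum_alt_LIMSEQ have "hterm (-1) sums L"
    unfolding L_def by (intro sums_LIMSEQ_Suc) (simp only:)
  note B = Abel_limit[OF this]
  have "eventually (\<lambda>x. x \<in> {0<..<1}) (at_left (1::real))"
    by (rule eventually_at_leftI[of 0]) auto
  hence "eventually (\<lambda>x. (\<Sum>n. a n * x ^ n) = (\<Sum>n. hterm (-1) n * x ^ n)\<^sup>2 / 2) (at_left 1)"
  proof eventually_elim
    case (elim x)
    hence x: "\<bar>- x\<bar> < 1" by simp
    have p: "(- x) ^ n = (-1) ^ n * x ^ n" for n by (rule power_minus)
    have "(\<lambda>n. 2 * harm (n - 1) / real n * (- x) ^ n / 2) sums ((\<Sum>n. 1 / real n * (- x) ^ n)\<^sup>2 / 2)"
      by (rule sums_divide[OF harm_gen_sums[OF x]])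
    moreover have "2 * harm (n - 1) / real n * (- x) ^ n / 2 = a n * x ^ n" for n
      unfolding p a_def hterm_def by simp
    moreover have "1 / real n * (- x) ^ n = hterm (-1) n * x ^ n" for n
      unfolding p hterm_def by simp
    ultimately show ?case by (simp add: sums_iff)
  qed
  moreover have "((\<lambda>x. (\<Sum>n. hterm (-1) n * x ^ n)\<^sup>2 / 2) \<longlongrightarrow> L\<^sup>2 / 2) (at_left 1)"
    by (intro tendsto_intros B) auto
  ultimately have "((\<lambda>x. \<Sum>n. a n * x ^ n) \<longlongrightarrow> L\<^sup>2 / 2) (at_left 1)"
    by (subst tendsto_cong)
  hence "euler_zeta [(1, -1), (1, 1)] = L\<^sup>2 / 2"
    by (rule tendsto_unique[OF _ A, rotated]) simp
  with lim show ?thesis by (simp only: L_def)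
qed

lemma tail_sum2_0: "tail_sum2 (hterm a) (hterm b) 0 M = zetaM [(1, a), (1, b)] M"
proof -
  have *: "{0<..n} = {1..n}" for n :: nat by auto
  show ?thesis
    unfolding tail_sum2_def tail_sum_def * zetaM_Cons[of 1 a] hsum_zetaM
    by (simp add: hsum_def hterm_def)
qed

lemma conv_tail_0: "conv_tail a b 0 M = zetaM [(1, a), (1, b)] M"
proof -
  have *: "{0<..n} = {1..n}" for n :: nat by auto
  show ?thesis
    unfolding conv_tail_def * zetaM_Cons[of 1 a] hsum_zetaM by (simp add: hterm_def)
qed

lemma tail_sum_0: "tail_sum (\<lambda>n. z ^ n / real n ^ s) 0 M = zetaM [(s, z)] M"
proof -
  have *: "{0<..n} = {1..n}" for n :: nat by auto
  show ?thesis unfolding tail_sum_def * by simp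
qed

declare zetaM.simps(2) [simp del]

text \<open>
  Each case of the theorem is determined by the coefficients \<open>A a b\<close> of the triple sums
  \<open>(1, a), (1, b), (u, e)\<close>. The first assumption on \<open>A\<close> is exactly what makes the main parts of the
  increments in \<open>q\<close> of both sides agree; \<open>R a\<close> stands for the tail of the harmonic sum of sign \<open>a\<close>.
\<close>
context
  fixes z1 z2 z3 e y :: real and u :: nat and A :: "real \<Rightarrow> real \<Rightarrow> real" and \<kappa> :: real
  assumes z: "z1 \<in> {1, -1}" "z2 \<in> {1, -1}" "z3 \<in> {1, -1}" and u: "u \<ge> 2"
  assumes e: "e = z2 * z3" and y: "y = z1 * z2"
  assumes A: "\<And>j R. (\<Sum>a\<in>{1,-1}. \<Sum>b\<in>{1,-1}. A a b * b ^ j * R a)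
                    = z1 ^ j * R y - z2 ^ j * R y + y ^ j * R z1"
  assumes lim0: "(\<lambda>M. zetaM [(1, z1), (1, z2)] M - zetaM [(2, z2)] M
        - (\<Sum>a\<in>{1,-1}. \<Sum>b\<in>{1,-1}. A a b * zetaM [(1, a), (1, b)] M)) \<longlonglongrightarrow> \<kappa>"
begin

text \<open>Here \<open>G\<close> collects the right-hand side. Its increments agree with those of
  \<open>conv_tail\<close> except for the tail beyond M - j, so the dominated convergence lemma
  applies to the difference \<open>\<delta>\<close>.\<close>

lemma weighted_sum_limit:
  "(\<lambda>M. (\<Sum>b=1..u. zetaM [(1, z1), (b, z2), (Suc u - b, z3)] M) + zetaM [(1, z1), (u, e), (1, z3)] M
      - (zetaM [(2, z2), (u, e)] M + zetaM [(1, z1), (Suc u, e * y)] M + zetaM [(1, z1), (u, e), (1, y)] M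
        + (\<Sum>a\<in>{1,-1}. \<Sum>b\<in>{1,-1}. A a b * zetaM [(1, a), (1, b), (u, e)] M)))
     \<longlonglongrightarrow> \<kappa> * euler_zeta [(u, e)]"
proof -
  define G where "G q M = tail_sum (\<lambda>n. z2 ^ n / real n ^ 2) q M + hsum y q * tail_sum (hterm z1) q M
     + (\<Sum>a\<in>{1,-1}. \<Sum>b\<in>{1,-1}. A a b * tail_sum2 (hterm a) (hterm b) q M)" for q M
  define \<delta> where "\<delta> q M = conv_tail z1 z2 q M - G q M" for q M
  have z1y: "z1 * y = z2" "z2\<^sup>2 = 1" "z3\<^sup>2 = 1" using z by (auto simp: y)
  have step: "\<delta> q M - \<delta> (Suc q) M = - (z1 ^ Suc q * tail_sum (hterm y) (M - Suc q) M / real (Suc q))"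
    if q: "q < M" for q M
  proof -
    define j where "j = Suc q"
    have j: "real j > 0" by (simp add: j_def)
    define Ry where "Ry = tail_sum (hterm y) j M"
    define R1 where "R1 = tail_sum (hterm z1) j M"
    have "(\<Sum>a\<in>{1,-1}. \<Sum>b\<in>{1,-1}. A a b * tail_sum2 (hterm a) (hterm b) q M)
       = (\<Sum>a\<in>{1,-1}. \<Sum>b\<in>{1,-1}. A a b * tail_sum2 (hterm a) (hterm b) j M)
         + (\<Sum>a\<in>{1,-1}. \<Sum>b\<in>{1,-1}. A a b * b ^ j * tail_sum (hterm a) j M) / real j"
      unfolding tail_sum2_step[of _ _ q] j_def[symmetric] hterm_def
      by (simp add: sum.distrib distrib_left add_divide_distrib algebra_simps)
    \<comment> \<open>Used with \<open>R a\<close> equal to the tail of \<open>hterm a\<close>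
      beyond j.\<close>
    also note A
    finally have "G q M - G j M = z2 ^ j / real j ^ 2 + (hsum y q * hterm z1 j - hterm y j * R1)
           + (z1 ^ j * Ry - z2 ^ j * Ry + y ^ j * R1) / real j"
      using q by (simp add: G_def tail_sum_step[of q M] j_def[symmetric] Ry_def R1_def
          hsum_Suc[of y q, folded j_def] algebra_simps)
    \<comment> \<open>Since z2 = z1 y, the contribution of (2, z2) is the diagonal term that
      completes \<open>hsum y q\<close> to \<open>hsum y j\<close>; the tail \<open>Ry\<close> then
      completes it to \<open>hsum y M\<close>.\<close>
    also have "z2 ^ j / real j ^ 2 = hterm z1 j * hterm y j"
      by (simp add: hterm_def power2_eq_square flip: z1y(1) add: power_mult_distrib)
    also have "hterm z1 j * hterm y j + (hsum y q * hterm z1 j - hterm y j * R1) + (z1 ^ j * Ry - z2 ^ j * Ry + y ^ j * R1) / real j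
       = (z1 ^ j * (hsum y q + hterm y j + Ry) - z2 ^ j * Ry) / real j"
      by (simp add: hterm_def add_divide_distrib diff_divide_distrib algebra_simps)
    also have "hsum y q + hterm y j + Ry = hsum y M"
      using hsum_plus_tail[of j M y] q by (simp add: Ry_def j_def hsum_Suc)
    finally have "G q M - G j M = (z1 ^ j * hsum y M - z2 ^ j * Ry) / real j" .
    moreover have "conv_tail z1 z2 q M - conv_tail z1 z2 j M
        = (z1 ^ j * (hsum y M - tail_sum (hterm y) (M - j) M) - z2 ^ j * Ry) / real j"
      using conv_tail_step[OF z1y(2) q, of z1] by (simp add: j_def[symmetric] y[symmetric] Ry_def)
    ultimately show ?thesis
      unfolding \<delta>_def j_def[symmetric] by (simp add: diff_divide_distrib right_diff_distrib)
  qed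
  have "\<delta> 0 = (\<lambda>M. zetaM [(1, z1), (1, z2)] M - zetaM [(2, z2)] M
        - (\<Sum>a\<in>{1,-1}. \<Sum>b\<in>{1,-1}. A a b * zetaM [(1, a), (1, b)] M))"
    unfolding \<delta>_def G_def conv_tail_0 tail_sum_0 tail_sum2_0 by (rule ext) simp
  with lim0 have "\<delta> 0 \<longlonglongrightarrow> \<kappa>" by (simp only:)
  from weighted_delta_tendsto[of z1 y e u \<delta> \<kappa>, OF _ _ _ u _ step this]
  have "(\<lambda>M. \<Sum>q=1..M. e ^ q / real q ^ u * \<delta> q M) \<longlonglongrightarrow> \<kappa> * euler_zeta [(u, e)]"
    using z by (auto simp: e y \<delta>_def G_def)
  moreover have "(\<Sum>q=1..M. e ^ q / real q ^ u * \<delta> q M) =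
      (\<Sum>b=1..u. zetaM [(1, z1), (b, z2), (Suc u - b, z3)] M) + zetaM [(1, z1), (u, e), (1, z3)] M
      - (zetaM [(2, z2), (u, e)] M + zetaM [(1, z1), (Suc u, e * y)] M + zetaM [(1, z1), (u, e), (1, y)] M
        + (\<Sum>a\<in>{1,-1}. \<Sum>b\<in>{1,-1}. A a b * zetaM [(1, a), (1, b), (u, e)] M))" for M
  proof -
    have h: "(\<lambda>n. z1 ^ n / real n ^ 1) = hterm z1" by (auto simp: hterm_def)
    \<comment> \<open>The index of depth two supplies the last term of \<open>hsum y q\<close>, the
      index of depth three supplies the rest.\<close>
    have "zetaM [(1, z1), (Suc u, e * y)] M + zetaM [(1, z1), (u, e), (1, y)] M
        = (\<Sum>q=1..M. e ^ q / real q ^ u * (hsum y q * tail_sum (hterm z1) q M))"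
      unfolding zetaM_depth2 zetaM_depth3_middle h sum.distrib[symmetric]
    proof (intro sum.cong refl)
      fix q assume "q \<in> {1..M}"
      then obtain m where m: "q = Suc m" by (cases q) auto
      have "(e * y) ^ q / real q ^ Suc u = e ^ q / real q ^ u * hterm y q"
        by (simp add: hterm_def power_mult_distrib)
      moreover have "hsum y q = hsum y (q - 1) + hterm y q" by (simp add: m hsum_Suc)
      ultimately show "(e * y) ^ q / real q ^ Suc u * tail_sum (hterm z1) q M
          + e ^ q / real q ^ u * (hsum y (q - 1) * tail_sum (hterm z1) q M)
          = e ^ q / real q ^ u * (hsum y q * tail_sum (hterm z1) q M)"
        by (simp only:) (simp add: algebra_simps)
    qed
    moreover have "(\<Sum>a\<in>{1,-1}. \<Sum>b\<in>{1,-1}. A a b * zetaM [(1, a), (1, b), (u, e)] M)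
       = (\<Sum>q=1..M. e ^ q / real q ^ u * (\<Sum>a\<in>{1,-1}. \<Sum>b\<in>{1,-1}. A a b * tail_sum2 (hterm a) (hterm b) q M))"
      unfolding zetaM_depth3_last
      by (simp add: sum_distrib_left sum.distrib distrib_left mult.left_commute)
    ultimately show ?thesis
      unfolding sum_depth3_weight[OF z1y(2,3), folded e] \<delta>_def G_def zetaM_depth2[of 2]
      by (simp add: sum.distrib sum_subtractf right_diff_distrib distrib_left del: zetaM.simps)
  qed
  ultimately show ?thesis by simp
qed

text \<open>Each truncated sum is its polynomial at log M + gamma plus o(1). The resulting
  combination of polynomials therefore tends to a constant along log M + gamma, which forces a
  polynomial identity.\<close>

lemma weighted_sum_zeta_st:
  "(\<Sum>b=1..u. zeta_st [(1, z1), (b, z2), (Suc u - b, z3)])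
     = zeta_st [(2, z2), (u, e)] + zeta_st [(1, z1), (Suc u, e * y)] + zeta_st [(1, z1), (u, e), (1, y)]
        + (\<Sum>a\<in>{1,-1}. \<Sum>b\<in>{1,-1}. smult (A a b) (zeta_st [(1, a), (1, b), (u, e)]))
        - zeta_st [(1, z1), (u, e), (1, z3)] + [:\<kappa> * euler_zeta [(u, e)]:]"
proof -
  define l where "l M = ln (real M) + (euler_mascheroni :: real)" for M
  define r where "r idx M = zetaM idx M - poly (zeta_st idx) (l M)" for idx M
  have r: "r idx \<longlonglongrightarrow> 0" if "zeta_quadratic idx" for idx
    using zeta_quadratic_tendsto[OF that] by (simp add: r_def[abs_def] l_def del: zetaM.simps)
  have sgn: "z1 = 1 \<or> z1 = -1" "z2 = 1 \<or> z2 = -1" "z3 = 1 \<or> z3 = -1" "e = 1 \<or> e = -1" "y = 1 \<or> y = -1"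
       "e * y = 1 \<or> e * y = -1"
    using z by (auto simp: e y)
  have q3: "zeta_quadratic [(1, x), (s, x'), (t, x'')]"
    if "x = 1 \<or> x = -1" "x' = 1 \<or> x' = -1" "x'' = 1 \<or> x'' = -1" "s \<ge> 1" "t \<ge> 1" "s \<ge> 2 \<or> t \<ge> 2" for x x' x'' s t
    using zeta_quadratic_triple[of x s x' t x''] that by blast
  define P where "P = (\<Sum>b=1..u. zeta_st [(1, z1), (b, z2), (Suc u - b, z3)]) + zeta_st [(1, z1), (u, e), (1, z3)]
     - (zeta_st [(2, z2), (u, e)] + zeta_st [(1, z1), (Suc u, e * y)] + zeta_st [(1, z1), (u, e), (1, y)]
        + (\<Sum>a\<in>{1,-1}. \<Sum>b\<in>{1,-1}. smult (A a b) (zeta_st [(1, a), (1, b), (u, e)])))"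
  have "(\<lambda>M. (\<Sum>b=1..u. r [(1, z1), (b, z2), (Suc u - b, z3)] M) + r [(1, z1), (u, e), (1, z3)] M
      - (r [(2, z2), (u, e)] M + r [(1, z1), (Suc u, e * y)] M + r [(1, z1), (u, e), (1, y)] M
        + (\<Sum>a\<in>{1,-1}. \<Sum>b\<in>{1,-1}. A a b * r [(1, a), (1, b), (u, e)] M)))
     \<longlonglongrightarrow> (\<Sum>b=1..u. 0) + 0 - (0 + 0 + 0 + (\<Sum>a\<in>{1,-1::real}. \<Sum>b\<in>{1,-1}. A a b * 0))"
    using sgn u by (intro tendsto_intros r q3 zeta_quadratic_pair(1)) auto
  from tendsto_diff[OF weighted_sum_limit this]
  have "(\<lambda>M. poly P (l M)) \<longlonglongrightarrow> \<kappa> * euler_zeta [(u, e)]"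
    by (simp add: P_def r_def poly_sum sum_subtractf algebra_simps del: zetaM.simps)
  hence "(\<lambda>M. poly (P - [:\<kappa> * euler_zeta [(u, e)]:]) (l M)) \<longlonglongrightarrow> 0"
    by (simp add: LIM_zero_iff)
  from poly_tendsto_0_imp_eq_0[OF this] have "P - [:\<kappa> * euler_zeta [(u, e)]:] = 0"
    using ln_plus_gamma_at_top by (simp add: l_def)
  thus ?thesis by (simp add: P_def algebra_simps)
qed

end

section \<open>The four sign patterns of the first two entries\<close>

lemma zeta_alt_alt_LIMSEQ:
  "zetaM [(1, -1), (1, -1)] \<longlonglongrightarrow> ((euler_zeta [br 1])\<^sup>2 - euler_zeta [pl 2]) / 2"
proof -
  have "zetaM [(1, -1), (1, -1)] = (\<lambda>M. ((hsum (-1) M)\<^sup>2 - zetaM [(2, 1)] M) / 2)"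
    by (rule ext) (simp add: hsum_square)
  thus ?thesis by (simp only:) (intro tendsto_intros hsum_alt_LIMSEQ zeta2_LIMSEQ, auto)
qed

text \<open>For y = 1 the condition on \<open>A\<close> reads R 1 on the right, so one coefficient
  suffices. The double sums cancel and leave the constant -zeta(2).\<close>

lemma sum_zeta_st_one_one:
  assumes "s \<in> {1, -1}" "u \<ge> 2"
  shows "(\<Sum>b=1..u. zeta_st [(1, 1), (b, 1), (Suc u - b, s)])
     = zeta_st [(2, 1), (u, s)] + zeta_st [(1, 1), (Suc u, s)] + zeta_st [(1, 1), (u, s), (1, 1)]
        + zeta_st [(1, 1), (1, 1), (u, s)] - zeta_st [(1, 1), (u, s), (1, s)]
        - [:euler_zeta [pl 2] * euler_zeta [(u, s)]:]"
proof -
  define A :: "real \<Rightarrow> real \<Rightarrow> real" where "A a b = (if a = 1 \<and> b = 1 then 1 else 0)" for a b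
  have "(\<lambda>M. zetaM [(1, 1), (1, 1)] M - zetaM [(2, 1)] M
        - (\<Sum>a\<in>{1,-1}. \<Sum>b\<in>{1,-1}. A a b * zetaM [(1, a), (1, b)] M)) \<longlonglongrightarrow> - euler_zeta [pl 2]"
    using tendsto_minus[OF zeta2_LIMSEQ] by (simp add: A_def)
  from weighted_sum_zeta_st[OF _ _ assms(1,2) refl refl _ this]
  show ?thesis by (simp add: A_def)
qed

text \<open>For y = -1 and z1 = 1 the condition on \<open>A\<close> reads R (-1) - (-1)^j R (-1) +
  (-1)^j R 1. The divergent double sums cancel, and the values of the remaining ones add up to
  0.\<close>

lemma sum_zeta_st_one_alt:
  assumes "s \<in> {1, -1}" "u \<ge> 2"
  shows "(\<Sum>b=1..u. zeta_st [(1, 1), (b, -1), (Suc u - b, s)])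
     = zeta_st [(2, -1), (u, -s)] + zeta_st [(1, 1), (Suc u, s)] + zeta_st [(1, 1), (u, -s), (1, -1)]
        + zeta_st [(1, 1), (1, -1), (u, -s)] + zeta_st [(1, -1), (1, 1), (u, -s)]
        - zeta_st [(1, -1), (1, -1), (u, -s)] - zeta_st [(1, 1), (u, -s), (1, s)]"
proof -
  define A :: "real \<Rightarrow> real \<Rightarrow> real" where
    "A a b = (if a = 1 then (if b = 1 then 0 else 1) else (if b = 1 then 1 else -1))" for a b
  have "(\<lambda>M. - zetaM [(2, -1)] M - zetaM [(1, -1), (1, 1)] M + zetaM [(1, -1), (1, -1)] M)
      \<longlonglongrightarrow> - (- euler_zeta [pl 2] / 2) - (euler_zeta [br 1])\<^sup>2 / 2 + ((euler_zeta [br 1])\<^sup>2 - euler_zeta [pl 2]) / 2"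
    by (intro tendsto_intros zeta2_alt_LIMSEQ zeta_alt_one_LIMSEQ zeta_alt_alt_LIMSEQ)
  hence "(\<lambda>M. zetaM [(1, 1), (1, -1)] M - zetaM [(2, -1)] M
        - (\<Sum>a\<in>{1,-1}. \<Sum>b\<in>{1,-1}. A a b * zetaM [(1, a), (1, b)] M)) \<longlonglongrightarrow> 0"
    by (simp add: A_def diff_divide_distrib algebra_simps)
  from weighted_sum_zeta_st[OF _ _ assms(1,2) refl refl _ this]
  show ?thesis by (simp add: A_def algebra_simps)
qed

text \<open>For z1 = y = -1 the first and third terms of the condition on \<open>A\<close> coincide,
  whence the coefficient 2. The constant again vanishes.\<close>

lemma sum_zeta_st_alt_one:
  assumes "s \<in> {1, -1}" "u \<ge> 2"
  shows "(\<Sum>b=1..u. zeta_st [(1, -1), (b, 1), (Suc u - b, s)])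
     = zeta_st [(2, 1), (u, s)] + zeta_st [(1, -1), (Suc u, -s)] + zeta_st [(1, -1), (u, s), (1, -1)]
        + 2 * zeta_st [(1, -1), (1, -1), (u, s)] - zeta_st [(1, -1), (1, 1), (u, s)]
        - zeta_st [(1, -1), (u, s), (1, s)]"
proof -
  define A :: "real \<Rightarrow> real \<Rightarrow> real" where
    "A a b = (if a = 1 then 0 else (if b = 1 then -1 else 2))" for a b
  have "(\<lambda>M. 2 * zetaM [(1, -1), (1, 1)] M - zetaM [(2, 1)] M - 2 * zetaM [(1, -1), (1, -1)] M)
      \<longlonglongrightarrow> 2 * ((euler_zeta [br 1])\<^sup>2 / 2) - euler_zeta [pl 2] - 2 * (((euler_zeta [br 1])\<^sup>2 - euler_zeta [pl 2]) / 2)"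
    by (intro tendsto_intros zeta2_LIMSEQ zeta_alt_one_LIMSEQ zeta_alt_alt_LIMSEQ)
  hence "(\<lambda>M. zetaM [(1, -1), (1, 1)] M - zetaM [(2, 1)] M
        - (\<Sum>a\<in>{1,-1}. \<Sum>b\<in>{1,-1}. A a b * zetaM [(1, a), (1, b)] M)) \<longlonglongrightarrow> 0"
    by (simp add: A_def diff_divide_distrib algebra_simps)
  from weighted_sum_zeta_st[OF _ _ assms(1,2) refl refl _ this]
  show ?thesis by (simp add: A_def algebra_simps numeral_poly)
qed

text \<open>For y = 1 the first two terms of the condition on \<open>A\<close> cancel and only R
  (-1) remains. The constant vanishes by the values of the double sums.\<close>

lemma sum_zeta_st_alt_alt:
  assumes "s \<in> {1, -1}" "u \<ge> 2"
  shows "(\<Sum>b=1..u. zeta_st [(1, -1), (b, -1), (Suc u - b, s)])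
     = zeta_st [(2, -1), (u, -s)] + zeta_st [(1, -1), (Suc u, -s)] + zeta_st [(1, -1), (u, -s), (1, 1)]
        + zeta_st [(1, -1), (1, 1), (u, -s)] - zeta_st [(1, -1), (u, -s), (1, s)]"
proof -
  define A :: "real \<Rightarrow> real \<Rightarrow> real" where "A a b = (if a = -1 \<and> b = 1 then 1 else 0)" for a b
  have "(\<lambda>M. zetaM [(1, -1), (1, -1)] M - zetaM [(2, -1)] M - zetaM [(1, -1), (1, 1)] M)
      \<longlonglongrightarrow> ((euler_zeta [br 1])\<^sup>2 - euler_zeta [pl 2]) / 2 - (- euler_zeta [pl 2] / 2) - (euler_zeta [br 1])\<^sup>2 / 2"
    by (intro tendsto_intros zeta2_alt_LIMSEQ zeta_alt_one_LIMSEQ zeta_alt_alt_LIMSEQ)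
  hence "(\<lambda>M. zetaM [(1, -1), (1, -1)] M - zetaM [(2, -1)] M
        - (\<Sum>a\<in>{1,-1}. \<Sum>b\<in>{1,-1}. A a b * zetaM [(1, a), (1, b)] M)) \<longlonglongrightarrow> 0"
    by (simp add: A_def diff_divide_distrib algebra_simps)
  from weighted_sum_zeta_st[OF _ _ assms(1,2) refl refl _ this]
  show ?thesis by (simp add: A_def)
qed

lemma sum_zeta_sh_one_alt:
  assumes "s \<in> {1, -1}" "u \<ge> 2"
  shows "(\<Sum>b=1..u. zeta_sh [(1, 1), (b, -1), (Suc u - b, s)]) = (\<Sum>b=1..u. zeta_st [(1, 1), (b, -1), (Suc u - b, s)])"
  by (intro sum.cong refl zeta_sh_eq_zeta_st zeta_triple_one(1))
     (use assms in \<open>auto simp: unit_signs_def\<close>)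

text \<open>Only the summand b = 1 has a quadratic term, so the regularizations differ there
  alone.\<close>

lemma sum_zeta_sh_one_one:
  assumes "s \<in> {1, -1}" "u \<ge> 2"
  shows "(\<Sum>b=1..u. zeta_sh [(1, 1), (b, 1), (Suc u - b, s)])
    = (\<Sum>b=1..u. zeta_st [(1, 1), (b, 1), (Suc u - b, s)]) + [:1/2 * euler_zeta [pl 2] * euler_zeta [(u, s)]:]"
proof -
  have "(\<Sum>b=1..u. zeta_sh [(1, 1), (b, 1), (Suc u - b, s)])
      = (\<Sum>b=1..u. zeta_st [(1, 1), (b, 1), (Suc u - b, s)]
          + (if b = 1 then [:1/2 * euler_zeta [pl 2] * euler_zeta [(u, s)]:] else 0))"
  proof (intro sum.cong refl)
    fix b assume b: "b \<in> {1..u}"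
    show "zeta_sh [(1, 1), (b, 1), (Suc u - b, s)] = zeta_st [(1, 1), (b, 1), (Suc u - b, s)]
          + (if b = 1 then [:1/2 * euler_zeta [pl 2] * euler_zeta [(u, s)]:] else 0)"
    proof (cases "b = 1")
      case True
      thus ?thesis using zeta_sh_one_one[of u s] assms by auto
    next
      case False
      have "zeta_sh [(1, 1), (b, 1), (Suc u - b, s)] = zeta_st [(1, 1), (b, 1), (Suc u - b, s)]"
        by (intro zeta_sh_eq_zeta_st zeta_triple_one(1)) (use assms False b in \<open>auto simp: unit_signs_def\<close>)
      thus ?thesis using False by simp
    qed
  qed
  also have "\<dots> = (\<Sum>b=1..u. zeta_st [(1, 1), (b, 1), (Suc u - b, s)]) + [:1/2 * euler_zeta [pl 2] * euler_zeta [(u, s)]:]"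
    unfolding sum.distrib using assms by simp
  finally show ?thesis .
qed

lemma sum_zc_alt:
  assumes "z \<in> {1, -1}" "s \<in> {1, -1}"
  shows "(\<Sum>b=1..u. zc [(1, -1), (b, z), (Suc u - b, s)]) = (\<Sum>b=1..u. zeta_st [(1, -1), (b, z), (Suc u - b, s)])"
  by (intro sum.cong refl zeta_convergent_zc zeta_triple_alt) (use assms in auto)

theorem theorem5p4:
  fixes w :: nat
  assumes "w \<ge> 4"
  defines "u \<equiv> w - 2" and "v \<equiv> w - 1"
  shows
   "(\<Sum>b = 1..v - 1. zeta_sh [pl 1, pl b, pl (v - b)])
      = zc [pl 2, pl u] + zeta_st [pl 1, pl v] + zeta_st [pl 1, pl 1, pl u]
        - [: 1/2 * euler_zeta [pl 2] * euler_zeta [pl u] :]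
    \<and> (\<Sum>b = 1..v - 1. zeta_sh [pl 1, br b, pl (v - b)])
      = zc [br 2, br u] + zeta_st [pl 1, pl v] + zeta_st [pl 1, br 1, br u]
        + zeta_st [pl 1, br u, br 1] + zc [br 1, pl 1, br u] - zc [br 1, br 1, br u]
        - zeta_st [pl 1, br u, pl 1]
    \<and> (\<Sum>b = 1..v - 1. zc [br 1, pl b, pl (v - b)])
      = zc [pl 2, pl u] + zc [br 1, br v] + zc [br 1, pl u, br 1] + 2 * zc [br 1, br 1, pl u]
        - zc [br 1, pl 1, pl u] - zc [br 1, pl u, pl 1]
    \<and> (\<Sum>b = 1..v - 1. zc [br 1, br b, pl (v - b)])
      = zc [br 2, br u] + zc [br 1, br v] + zc [br 1, pl 1, br u]
    \<and> (\<Sum>b = 1..v - 1. zc [br 1, br b, br (v - b)])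
      = zc [br 2, pl u] + zc [br 1, pl v] + zc [br 1, pl u, pl 1] + zc [br 1, pl 1, pl u]
        - zc [br 1, pl u, br 1]
    \<and> (\<Sum>b = 1..v - 1. zeta_sh [pl 1, pl b, br (v - b)])
      = zc [pl 2, br u] + zeta_st [pl 1, br v] + zeta_st [pl 1, br u, pl 1]
        + zeta_st [pl 1, pl 1, br u] - zeta_sh [pl 1, br u, br 1]
        - [: 1/2 * euler_zeta [pl 2] * euler_zeta [br u] :]
    \<and> (\<Sum>b = 1..v - 1. zeta_sh [pl 1, br b, br (v - b)])
      = zc [br 2, pl u] + zeta_st [pl 1, br v] + zeta_st [pl 1, br 1, pl u]
        + zc [br 1, pl 1, pl u] - zc [br 1, br 1, pl u]
    \<and> (\<Sum>b = 1..v - 1. zc [br 1, pl b, br (v - b)])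
      = zc [pl 2, br u] + zc [br 1, pl v] + 2 * zc [br 1, br 1, br u] - zc [br 1, pl 1, br u]"
proof -
  have u: "u \<ge> 2" and v: "v = Suc u" using assms by auto
  have s: "1 \<in> {1, -1::real}" "-1 \<in> {1, -1::real}" by auto
  have zc2: "zc [(2, x), (t, y)] = zeta_st [(2, x), (t, y)]"
    if "x = 1 \<or> x = -1" "t \<ge> 1" "y = 1 \<or> y = -1" for x y :: real and t
    using that by (auto intro!: zeta_convergent_zc zeta_quadratic_pair(2))
  have zca: "zc [(1, -1), (t, y)] = zeta_st [(1, -1), (t, y)]"
    if "t \<ge> 1" "y = 1 \<or> y = -1" for y :: real and t
    using that by (auto intro!: zeta_convergent_zc zeta_quadratic_pair(2))
  have zc3: "zc [(1, -1), (t, x), (t', y)] = zeta_st [(1, -1), (t, x), (t', y)]"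
    if "t \<ge> 1" "x = 1 \<or> x = -1" "t' \<ge> 1" "y = 1 \<or> y = -1" for x y :: real and t t'
    using that by (intro zeta_convergent_zc zeta_triple_alt)
  have sh: "zeta_sh [(1, 1), (u, -1), (1, -1)] = zeta_st [(1, 1), (u, -1), (1, -1)]"
    by (intro zeta_sh_eq_zeta_st zeta_triple_one(1)) (use u in \<open>auto simp: unit_signs_def\<close>)
  \<comment> \<open>The constant -zeta(2) zeta(u) of the harmonic identity and the correction +1/2
    zeta(2) zeta(u) of the shuffle regularization combine to the coefficient -1/2.\<close>
  have half: "P - [:c * x:] + [:1/2 * c * x:] = P - [:1/2 * c * x:]" for P :: "real poly" and c x
    by (simp add: algebra_simps)
  have le: "1 \<le> u" "1 \<le> Suc u" "1 \<le> (1::nat)" using u by auto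
  note to_st = zc2 zca zc3 sh le minus_minus simp_thms
  note sums = sum_zeta_sh_one_one[OF _ u] sum_zeta_sh_one_alt[OF _ u] sum_zc_alt
    sum_zeta_st_one_one[OF _ u] sum_zeta_st_one_alt[OF _ u] sum_zeta_st_alt_one[OF _ u] sum_zeta_st_alt_alt[OF _ u]
  \<comment> \<open>The eight identities are the four sign patterns with s = 1 or s = -1. In four of
    them the two terms with u in the middle entry coincide and cancel.\<close>
  show ?thesis
    unfolding v pl_def br_def diff_Suc_1
    by (intro conjI; simp only: sums[unfolded pl_def] s half to_st; simp only: algebra_simps add_diff_cancel_left' add_diff_cancel)
qed

end
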